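(* Let $G=\prod_{i=1}^\infty G_i$ be the (compact) product of a sequence of finite groups $G_i$, each of which is non-abelian. Then $\mathrm{ZL}^1(G)$ is not amenable.
   Context: For a compact group $G$, $\mathrm{L}^1(G)$ is the group algebra with respect to normalised Haar measure, under convolution, and $\mathrm{ZL}^1(G)=\{f\in \mathrm{L}^1(G): f*g=g*f \text{ for all } g\in \mathrm{L}^1(G)\}$ is its centre. A Banach algebra $\mathfrak{A}$ is amenable if it has a bounded approximate diagonal: a bounded net $(\mu_\alpha)$ in the projective tensor product $\mathfrak{A}\hat{\otimes}\mathfrak{A}$ with $m(\mu_\alpha)a\to a$, $a\,m(\mu_\alpha)\to a$ and $a\cdot\mu_\alpha-\mu_\alpha\cdot a\to 0$ for all $a\in\mathfrak{A}$, where $m$ is the multiplication map and $a\cdot(b\otimes c)=ab\otimes c$, $(b\otimes c)\cdot a=b\otimes ca$. *)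

theory Defs
  imports "HOL-Probability.Probability" "HOL-Algebra.Product_Groups"
begin

definition haar :: "(nat \<Rightarrow> 'a monoid) \<Rightarrow> (nat \<Rightarrow> 'a) measure" where
  "haar G = (\<Pi>\<^sub>M i\<in>UNIV. uniform_count_measure (carrier (G i)))"

definition conv :: "(nat \<Rightarrow> 'a monoid) \<Rightarrow> ((nat \<Rightarrow> 'a) \<Rightarrow> complex) \<Rightarrow>
    ((nat \<Rightarrow> 'a) \<Rightarrow> complex) \<Rightarrow> (nat \<Rightarrow> 'a) \<Rightarrow> complex" where
  "conv G f g = (\<lambda>x. \<integral>y. f y * g (inv\<^bsub>product_group UNIV G\<^esub> y \<otimes>\<^bsub>product_group UNIV G\<^esub> x) \<partial>haar G)"

text \<open>L1 norm (a seminorm on integrable functions; L1 elements are taken modulo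
  a.e. equality, which all notions below respect).\<close>
definition L1norm :: "(nat \<Rightarrow> 'a monoid) \<Rightarrow> ((nat \<Rightarrow> 'a) \<Rightarrow> complex) \<Rightarrow> real" where
  "L1norm G f = (\<integral>x. cmod (f x) \<partial>haar G)"

definition ZL1 :: "(nat \<Rightarrow> 'a monoid) \<Rightarrow> ((nat \<Rightarrow> 'a) \<Rightarrow> complex) set" where
  "ZL1 G = {f. integrable (haar G) f \<and>
     (\<forall>g. integrable (haar G) g \<longrightarrow> (AE x in haar G. conv G f g x = conv G g f x))}"

text \<open>Bounded bilinear forms on ZL1(G) x ZL1(G); these are exactly the continuous
  linear functionals on the projective tensor product.\<close>
definition bounded_bilinear_form ::
  "(nat \<Rightarrow> 'a monoid) \<Rightarrow> (((nat \<Rightarrow> 'a) \<Rightarrow> complex) \<Rightarrow> ((nat \<Rightarrow> 'a) \<Rightarrow> complex) \<Rightarrow> complex) \<Rightarrow> bool" where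
  "bounded_bilinear_form G \<phi> \<longleftrightarrow>
     (\<forall>a\<in>ZL1 G. \<forall>b\<in>ZL1 G. \<forall>c\<in>ZL1 G.
        \<phi> (\<lambda>x. a x + b x) c = \<phi> a c + \<phi> b c \<and> \<phi> a (\<lambda>x. b x + c x) = \<phi> a b + \<phi> a c) \<and>
     (\<forall>s. \<forall>a\<in>ZL1 G. \<forall>b\<in>ZL1 G.
        \<phi> (\<lambda>x. s * a x) b = s * \<phi> a b \<and> \<phi> a (\<lambda>x. s * b x) = s * \<phi> a b) \<and>
     (\<exists>C. \<forall>a\<in>ZL1 G. \<forall>b\<in>ZL1 G. cmod (\<phi> a b) \<le> C * L1norm G a * L1norm G b)"

text \<open>Elements of the projective tensor product ZL1 \<otimes>^ ZL1 are represented by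
  sequences (a_n, b_n) with sum ||a_n|| ||b_n|| < \<infinity>, standing for sum a_n \<otimes> b_n.\<close>
type_synonym 'a tensor = "nat \<Rightarrow> ((nat \<Rightarrow> 'a) \<Rightarrow> complex) \<times> ((nat \<Rightarrow> 'a) \<Rightarrow> complex)"

definition tensor_rep :: "(nat \<Rightarrow> 'a monoid) \<Rightarrow> 'a tensor \<Rightarrow> bool" where
  "tensor_rep G u \<longleftrightarrow> (\<forall>n. fst (u n) \<in> ZL1 G \<and> snd (u n) \<in> ZL1 G) \<and>
     summable (\<lambda>n. L1norm G (fst (u n)) * L1norm G (snd (u n)))"

text \<open>Two representations give the same element of the projective tensor product
  iff every continuous functional (= bounded bilinear form) agrees on them.\<close>
definition tensor_eq :: "(nat \<Rightarrow> 'a monoid) \<Rightarrow> 'a tensor \<Rightarrow> 'a tensor \<Rightarrow> bool" where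
  "tensor_eq G u v \<longleftrightarrow> (\<forall>\<phi>. bounded_bilinear_form G \<phi> \<longrightarrow>
     (\<Sum>n. \<phi> (fst (u n)) (snd (u n))) = (\<Sum>n. \<phi> (fst (v n)) (snd (v n))))"

definition proj_norm :: "(nat \<Rightarrow> 'a monoid) \<Rightarrow> 'a tensor \<Rightarrow> real" where
  "proj_norm G u = Inf {(\<Sum>n. L1norm G (fst (v n)) * L1norm G (snd (v n))) | v.
       tensor_rep G v \<and> tensor_eq G u v}"

text \<open>Multiplication map m(sum a_n \<otimes> b_n) = sum a_n * b_n (the series converges in L1
  and pointwise a.e.).\<close>
definition mult_map :: "(nat \<Rightarrow> 'a monoid) \<Rightarrow> 'a tensor \<Rightarrow> (nat \<Rightarrow> 'a) \<Rightarrow> complex" where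
  "mult_map G u = (\<lambda>x. \<Sum>n. conv G (fst (u n)) (snd (u n)) x)"

definition lmod :: "(nat \<Rightarrow> 'a monoid) \<Rightarrow> ((nat \<Rightarrow> 'a) \<Rightarrow> complex) \<Rightarrow> 'a tensor \<Rightarrow> 'a tensor" where
  "lmod G a u = (\<lambda>n. (conv G a (fst (u n)), snd (u n)))"

definition rmod :: "(nat \<Rightarrow> 'a monoid) \<Rightarrow> 'a tensor \<Rightarrow> ((nat \<Rightarrow> 'a) \<Rightarrow> complex) \<Rightarrow> 'a tensor" where
  "rmod G u a = (\<lambda>n. (fst (u n), conv G (snd (u n)) a))"

definition tensor_diff :: "'a tensor \<Rightarrow> 'a tensor \<Rightarrow> 'a tensor" where
  "tensor_diff u v = (\<lambda>n. if even n then u (n div 2)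
       else ((\<lambda>x. - fst (v (n div 2)) x), snd (v (n div 2))))"

text \<open>A bounded approximate diagonal for ZL1(G), indexed as a net by a proper filter F.\<close>
definition bounded_approx_diagonal ::
  "(nat \<Rightarrow> 'a monoid) \<Rightarrow> 'i filter \<Rightarrow> ('i \<Rightarrow> 'a tensor) \<Rightarrow> bool" where
  "bounded_approx_diagonal G F \<mu> \<longleftrightarrow>
     (\<forall>i. tensor_rep G (\<mu> i)) \<and>
     (\<exists>B. \<forall>i. proj_norm G (\<mu> i) \<le> B) \<and>
     (\<forall>a\<in>ZL1 G.
        ((\<lambda>i. L1norm G (\<lambda>x. conv G (mult_map G (\<mu> i)) a x - a x)) \<longlongrightarrow> 0) F \<and>
        ((\<lambda>i. L1norm G (\<lambda>x. conv G a (mult_map G (\<mu> i)) x - a x)) \<longlongrightarrow> 0) F \<and>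
        ((\<lambda>i. proj_norm G (tensor_diff (lmod G a (\<mu> i)) (rmod G (\<mu> i) a))) \<longlongrightarrow> 0) F)"

end

theory Submission
  imports Defs
begin

text \<open>
  Suppose a bounded approximate diagonal exists. Fix n, let H be the product of the first n
  groups and project everything to functions on H x H by integrating over cylinders. Using the
  approximate diagonal identity for class indicators and for the unit of H, the projections
  converge to a matrix M(x, y) determined by t = M(-, 1). This t is the convolution inverse of
  the distribution of commutators in H: the operator (K f)(x) = E_{s,b} f(s b s^-1 b^-1 x) is an
  average of operators A* A with A convolution by a class average. Hence K is at least 1 / |H|,
  so t exists and is unique, and it is the product of the solutions of the factors.

  Testing M against the indicator of the pairs with x conjugate to y^-1 gives a lower bound for
  the norm that is multiplicative over the factors: the sum over x of W(x) N(x), with W(x) the size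
  of the class of x and N a function of total mass 1. Since K^2 \<le> K one has
  N(x) \<ge> 1 / (|H| W(x)). Let q be the N-mass of the noncentral elements of a
  nonabelian factor. Their classes have at least two elements, so the sum is at least 1 + q; at least half of all elements are
  noncentral, so it is also at least (1 - q) + 1/2. Thus every factor contributes at least 5/4
  and the norms are at least (5/4)^n for every n.
\<close>

section \<open>Finite groups\<close>

text \<open>For a finite group H the centre of the group algebra is amenable, so no finite level
  gives a contradiction by itself. Only the norm of the diagonal can obstruct, hence a bound that
  multiplies over the factors. Commutators enter as follows. A tensor projected to H is a matrix
  M(x, y) of masses. Acting with the uniform distribution on a class and reading the diagonal
  identity at second argument 1 gives M(x, y) as the average of t(h y h^-1 x) over h. Inserting this
  into the condition that multiplication sends M to the point mass at 1 yields |H| K t = that point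
  mass. Positivity takes the place of character theory. Each A is a convolution by a probability,
  hence a contraction, and this is what gives K^2 \<le> K. Together with the term b = 1 of the
  average, which gives K \<ge> 1 / |H|, it yields solvability by a Neumann series; applied to class
  averages of t, it yields the pointwise bound for N. The mass q is not known, so two bounds are
  kept, one increasing and one decreasing in q. They cross at q = 1/4, which is where 5/4 comes
  from.\<close>

definition class_avg :: "'a monoid \<Rightarrow> 'a \<Rightarrow> ('a \<Rightarrow> real) \<Rightarrow> 'a \<Rightarrow> real" where
  "class_avg H a f x =
     (\<Sum>h\<in>carrier H. f (h \<otimes>\<^bsub>H\<^esub> a \<otimes>\<^bsub>H\<^esub> inv\<^bsub>H\<^esub> h \<otimes>\<^bsub>H\<^esub> x)) / card (carrier H)"

text \<open>The operator K of the introduction: reindexing turns this double average into the average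
  of f(s b s^-1 b^-1 x) over all s and b.\<close>
definition comm_op :: "'a monoid \<Rightarrow> ('a \<Rightarrow> real) \<Rightarrow> 'a \<Rightarrow> real" where
  "comm_op H f x =
     (\<Sum>a\<in>carrier H. class_avg H (inv\<^bsub>H\<^esub> a) (class_avg H a f) x) / card (carrier H)"

definition unit_ind :: "'a monoid \<Rightarrow> 'a \<Rightarrow> real" where
  "unit_ind H x = (if x = \<one>\<^bsub>H\<^esub> then 1 else 0)"

definition conj_class :: "'a monoid \<Rightarrow> 'a \<Rightarrow> 'a set" where
  "conj_class H x = (\<lambda>h. h \<otimes>\<^bsub>H\<^esub> x \<otimes>\<^bsub>H\<^esub> inv\<^bsub>H\<^esub> h) ` carrier H"

text \<open>The function N of the introduction; for a class function t the outer average is redundant.\<close>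
definition diag_weight :: "'a monoid \<Rightarrow> ('a \<Rightarrow> real) \<Rightarrow> 'a \<Rightarrow> real" where
  "diag_weight H t x =
     (\<Sum>h\<in>carrier H. class_avg H (inv\<^bsub>H\<^esub> x) t (h \<otimes>\<^bsub>H\<^esub> x \<otimes>\<^bsub>H\<^esub> inv\<^bsub>H\<^esub> h)) / card (carrier H)"

locale fin_group = group H for H :: "'a monoid" (structure) +
  assumes fin: "finite (carrier H)"
begin

section \<open>Class averages as operators, and positivity of \<open>comm_op\<close>\<close>

lemma card_pos: "real (card (carrier H)) > 0"
  using fin one_closed by (metis card_gt_0_iff empty_iff of_nat_0_less_iff)

lemma inv_mult_cancel [simp]:
  assumes "x \<in> carrier H" "y \<in> carrier H"
  shows "inv x \<otimes> (x \<otimes> y) = y" "x \<otimes> (inv x \<otimes> y) = y"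
  using assms by (simp_all flip: m_assoc)

lemma sum_lmult:
  assumes "g \<in> carrier H"
  shows "(\<Sum>x\<in>carrier H. f (g \<otimes> x)) = (\<Sum>x\<in>carrier H. f x)"
  using assms by (intro sum.reindex_bij_witness[of _ "\<lambda>x. inv g \<otimes> x" "\<lambda>x. g \<otimes> x"]) auto

lemma sum_inv: "(\<Sum>x\<in>carrier H. f (inv x)) = (\<Sum>x\<in>carrier H. f x)"
  by (intro sum.reindex_bij_witness[of _ "\<lambda>x. inv x" "\<lambda>x. inv x"]) auto

text \<open>\<open>class_avg H a\<close> is left convolution by the uniform distribution on the
  class of inv a. The adjoint of a translation is the inverse translation, so passing to the adjoint
  inverts the class.\<close>

lemma class_avg_adjoint:
  assumes a: "a \<in> carrier H"
  shows "(\<Sum>x\<in>carrier H. class_avg H a f x * g x) = (\<Sum>x\<in>carrier H. f x * class_avg H (inv a) g x)"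
proof -
  have eq: "(\<Sum>x\<in>carrier H. f (h \<otimes> a \<otimes> inv h \<otimes> x) * g x) =
    (\<Sum>x\<in>carrier H. f x * g (h \<otimes> inv a \<otimes> inv h \<otimes> x))" if h: "h \<in> carrier H" for h
    using a h
    by (intro sum.reindex_bij_witness[of _ "\<lambda>x. h \<otimes> inv a \<otimes> inv h \<otimes> x" "\<lambda>x. h \<otimes> a \<otimes> inv h \<otimes> x"])
       (auto simp: m_assoc)
  have "(\<Sum>x\<in>carrier H. class_avg H a f x * g x) =
      (\<Sum>h\<in>carrier H. \<Sum>x\<in>carrier H. f (h \<otimes> a \<otimes> inv h \<otimes> x) * g x) / card (carrier H)"
    unfolding class_avg_def
    by (subst sum.swap) (simp add: sum_divide_distrib sum_distrib_right)
  also have "\<dots> = (\<Sum>h\<in>carrier H. \<Sum>x\<in>carrier H. f x * g (h \<otimes> inv a \<otimes> inv h \<otimes> x)) / card (carrier H)"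
    using eq by simp
  also have "\<dots> = (\<Sum>x\<in>carrier H. f x * class_avg H (inv a) g x)"
    unfolding class_avg_def
    by (subst sum.swap) (simp add: sum_divide_distrib sum_distrib_left)
  finally show ?thesis .
qed

lemma square_avg_le:
  fixes f :: "'a \<Rightarrow> real"
  shows "((\<Sum>h\<in>carrier H. f h) / card (carrier H))\<^sup>2 \<le> (\<Sum>h\<in>carrier H. (f h)\<^sup>2) / card (carrier H)"
  using sum_squared_le_sum_of_squares[of f "carrier H"] card_pos
  by (simp add: power_divide divide_simps power2_eq_square mult_ac)

text \<open>Each summand only permutes the values of f, so an average of them cannot increase the l2
  norm.\<close>

lemma class_avg_contraction:
  assumes a: "a \<in> carrier H"
  shows "(\<Sum>x\<in>carrier H. (class_avg H a f x)\<^sup>2) \<le> (\<Sum>x\<in>carrier H. (f x)\<^sup>2)"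
proof -
  have "(\<Sum>x\<in>carrier H. (class_avg H a f x)\<^sup>2) \<le>
     (\<Sum>x\<in>carrier H. (\<Sum>h\<in>carrier H. (f (h \<otimes> a \<otimes> inv h \<otimes> x))\<^sup>2) / card (carrier H))"
    unfolding class_avg_def by (intro sum_mono square_avg_le)
  also have "\<dots> = (\<Sum>h\<in>carrier H. \<Sum>x\<in>carrier H. (f (h \<otimes> a \<otimes> inv h \<otimes> x))\<^sup>2) / card (carrier H)"
    by (subst sum.swap) (simp add: sum_divide_distrib)
  also have "\<dots> = (\<Sum>h\<in>carrier H. \<Sum>x\<in>carrier H. (f x)\<^sup>2) / card (carrier H)"
    using a sum_lmult[of _ "\<lambda>x. (f x)\<^sup>2"] by simp
  also have "\<dots> = (\<Sum>x\<in>carrier H. (f x)\<^sup>2)"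
    using card_pos by simp
  finally show ?thesis .
qed

lemma comm_op_form:
  "(\<Sum>x\<in>carrier H. f x * comm_op H f x) =
   (\<Sum>a\<in>carrier H. \<Sum>x\<in>carrier H. (class_avg H a f x)\<^sup>2) / card (carrier H)"
proof -
  have "(\<Sum>x\<in>carrier H. f x * comm_op H f x) =
     (\<Sum>a\<in>carrier H. \<Sum>x\<in>carrier H. f x * class_avg H (inv a) (class_avg H a f) x) / card (carrier H)"
    unfolding comm_op_def by (subst sum.swap) (simp add: sum_divide_distrib sum_distrib_left)
  also have "\<dots> = (\<Sum>a\<in>carrier H. \<Sum>x\<in>carrier H. (class_avg H a f x)\<^sup>2) / card (carrier H)"
    by (simp add: class_avg_adjoint[symmetric] power2_eq_square)
  finally show ?thesis .
qed

text \<open>This is K^2 \<le> K. Jensen over a, then contractivity of the outer class average,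
  leaves exactly the mean of the squared norms of \<open>class_avg H a f\<close>, which is the
  quadratic form of K.\<close>

lemma comm_op_le_form:
  "(\<Sum>x\<in>carrier H. (comm_op H f x)\<^sup>2) \<le> (\<Sum>x\<in>carrier H. f x * comm_op H f x)"
proof -
  have "(\<Sum>x\<in>carrier H. (comm_op H f x)\<^sup>2) \<le>
     (\<Sum>x\<in>carrier H. (\<Sum>a\<in>carrier H. (class_avg H (inv a) (class_avg H a f) x)\<^sup>2) / card (carrier H))"
    unfolding comm_op_def by (intro sum_mono square_avg_le)
  also have "\<dots> = (\<Sum>a\<in>carrier H. \<Sum>x\<in>carrier H. (class_avg H (inv a) (class_avg H a f) x)\<^sup>2) / card (carrier H)"
    by (subst sum.swap) (simp add: sum_divide_distrib)
  also have "\<dots> \<le> (\<Sum>a\<in>carrier H. \<Sum>x\<in>carrier H. (class_avg H a f x)\<^sup>2) / card (carrier H)"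
    by (intro divide_right_mono sum_mono class_avg_contraction) auto
  finally show ?thesis by (simp add: comm_op_form)
qed

lemma class_avg_one: "x \<in> carrier H \<Longrightarrow> class_avg H \<one> f x = f x"
  using card_pos by (simp add: class_avg_def)

text \<open>All terms of the form are squares, and the term a = 1 alone is already the squared norm
  of f.\<close>

lemma comm_op_coercive:
  "(\<Sum>x\<in>carrier H. (f x)\<^sup>2) \<le> card (carrier H) * (\<Sum>x\<in>carrier H. f x * comm_op H f x)"
proof -
  have "(\<Sum>x\<in>carrier H. (class_avg H \<one> f x)\<^sup>2) \<le>
        (\<Sum>a\<in>carrier H. \<Sum>x\<in>carrier H. (class_avg H a f x)\<^sup>2)"
    by (rule member_le_sum) (auto intro: sum_nonneg fin)
  then show ?thesis
    using card_pos by (simp add: comm_op_form class_avg_one)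
qed

text \<open>Quantitative injectivity: by the arithmetic-geometric mean inequality, coercivity of the
  form becomes a bound by the norm of |H| K f. This later turns convergence of the images under |H|
  K into convergence of the functions themselves.\<close>

lemma comm_op_bounded_below:
  "(\<Sum>x\<in>carrier H. (f x)\<^sup>2) \<le> (\<Sum>x\<in>carrier H. (card (carrier H) * comm_op H f x)\<^sup>2)"
proof -
  have "(\<Sum>x\<in>carrier H. (f x)\<^sup>2) \<le> (\<Sum>x\<in>carrier H. f x * (card (carrier H) * comm_op H f x))"
    using comm_op_coercive[of f] by (simp add: sum_distrib_left mult_ac)
  also have "\<dots> \<le> (\<Sum>x\<in>carrier H. ((f x)\<^sup>2 + (card (carrier H) * comm_op H f x)\<^sup>2) / 2)"
  proof (intro sum_mono)
    fix x show "f x * (card (carrier H) * comm_op H f x) \<le> ((f x)\<^sup>2 + (card (carrier H) * comm_op H f x)\<^sup>2) / 2"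
      using sum_squares_bound[of "f x" "card (carrier H) * comm_op H f x"] by simp
  qed
  also have "\<dots> = ((\<Sum>x\<in>carrier H. (f x)\<^sup>2) + (\<Sum>x\<in>carrier H. (card (carrier H) * comm_op H f x)\<^sup>2)) / 2"
    by (simp add: sum.distrib flip: sum_divide_distrib)
  finally show ?thesis by simp
qed

lemma class_avg_cong:
  assumes "a \<in> carrier H" "x \<in> carrier H" "\<And>y. y \<in> carrier H \<Longrightarrow> f y = g y"
  shows "class_avg H a f x = class_avg H a g x"
  using assms by (simp add: class_avg_def)

text \<open>Uniform distributions on classes are central. For a fixed class element g, replacing k
  by g k conjugates the other class element by g, which moves g past it.\<close>

lemma class_avg_commute:
  assumes "a \<in> carrier H" "b \<in> carrier H" "x \<in> carrier H"
  shows "class_avg H a (class_avg H b f) x = class_avg H b (class_avg H a f) x"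
proof -
  have "(\<Sum>h\<in>carrier H. \<Sum>k\<in>carrier H. f (k \<otimes> b \<otimes> inv k \<otimes> (h \<otimes> a \<otimes> inv h \<otimes> x))) =
        (\<Sum>h\<in>carrier H. \<Sum>k\<in>carrier H. f (h \<otimes> a \<otimes> inv h \<otimes> (k \<otimes> b \<otimes> inv k \<otimes> x)))"
  proof (rule sum.cong[OF refl])
    fix h assume h: "h \<in> carrier H"
    define g where "g = h \<otimes> a \<otimes> inv h"
    have g: "g \<in> carrier H" using h assms by (simp add: g_def)
    have "(\<Sum>k\<in>carrier H. f (k \<otimes> b \<otimes> inv k \<otimes> (g \<otimes> x))) =
          (\<Sum>k\<in>carrier H. f (g \<otimes> k \<otimes> b \<otimes> inv (g \<otimes> k) \<otimes> (g \<otimes> x)))"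
      using g sum_lmult[of g "\<lambda>k. f (k \<otimes> b \<otimes> inv k \<otimes> (g \<otimes> x))"] by simp
    also have "\<dots> = (\<Sum>k\<in>carrier H. f (g \<otimes> (k \<otimes> b \<otimes> inv k \<otimes> x)))"
      using g assms by (intro sum.cong refl) (simp add: m_assoc inv_mult_group)
    finally show "(\<Sum>k\<in>carrier H. f (k \<otimes> b \<otimes> inv k \<otimes> (h \<otimes> a \<otimes> inv h \<otimes> x))) =
        (\<Sum>k\<in>carrier H. f (h \<otimes> a \<otimes> inv h \<otimes> (k \<otimes> b \<otimes> inv k \<otimes> x)))"
      by (simp add: g_def)
  qed
  also have "\<dots> = (\<Sum>k\<in>carrier H. \<Sum>h\<in>carrier H. f (h \<otimes> a \<otimes> inv h \<otimes> (k \<otimes> b \<otimes> inv k \<otimes> x)))"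
    by (rule sum.swap)
  finally show ?thesis
    by (simp add: class_avg_def flip: sum_divide_distrib)
qed

lemma class_avg_sum:
  "class_avg H a (\<lambda>y. (\<Sum>i\<in>I. f i y) / c) x = (\<Sum>i\<in>I. class_avg H a (f i) x) / c"
  unfolding class_avg_def
  by (simp add: sum.swap[of _ I] flip: sum_divide_distrib)

text \<open>With this, applying a class average to the equation for t yields an equation for the
  class average of t.\<close>

lemma comm_op_class_avg:
  assumes "b \<in> carrier H" "x \<in> carrier H"
  shows "comm_op H (class_avg H b f) x = class_avg H b (comm_op H f) x"
proof -
  have "class_avg H (inv a) (class_avg H a (class_avg H b f)) x =
        class_avg H b (class_avg H (inv a) (class_avg H a f)) x" if "a \<in> carrier H" for a
  proof -
    have "class_avg H (inv a) (class_avg H a (class_avg H b f)) x =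
          class_avg H (inv a) (class_avg H b (class_avg H a f)) x"
      using that assms by (intro class_avg_cong class_avg_commute) auto
    also have "\<dots> = class_avg H b (class_avg H (inv a) (class_avg H a f)) x"
      using that assms by (intro class_avg_commute) auto
    finally show ?thesis .
  qed
  then show ?thesis
    unfolding comm_op_def class_avg_sum by simp
qed

lemma sum_class_avg:
  assumes "a \<in> carrier H"
  shows "(\<Sum>x\<in>carrier H. class_avg H a f x) = (\<Sum>x\<in>carrier H. f x)"
  using class_avg_adjoint[OF assms, of f "\<lambda>_. 1"] card_pos by (simp add: class_avg_def)

text \<open>The class average of the point mass at the identity, taken at inv x, is the uniform
  distribution on the class of x. Pairing with it therefore averages v over that class.\<close>

lemma sum_class_avg_unit:
  assumes "x \<in> carrier H"
  shows "(\<Sum>y\<in>carrier H. v y * class_avg H (inv x) (unit_ind H) y) =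
         (\<Sum>h\<in>carrier H. v (h \<otimes> x \<otimes> inv h)) / card (carrier H)"
proof -
  have "(\<Sum>y\<in>carrier H. v y * class_avg H (inv x) (unit_ind H) y) =
        (\<Sum>y\<in>carrier H. class_avg H x v y * unit_ind H y)"
    using assms by (simp add: class_avg_adjoint)
  also have "\<dots> = class_avg H x v \<one>"
    by (simp add: unit_ind_def fin if_distrib cong: if_cong)
  finally show ?thesis using assms by (simp add: class_avg_def)
qed

section \<open>Conjugacy classes and the lower bound for \<open>diag_weight\<close>\<close>

lemma conj_class_subset: "x \<in> carrier H \<Longrightarrow> conj_class H x \<subseteq> carrier H"
  by (auto simp: conj_class_def)

lemma finite_conj_class: "finite (conj_class H x)"
  by (simp add: conj_class_def fin)

lemma self_in_conj_class: "x \<in> carrier H \<Longrightarrow> x \<in> conj_class H x"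
  by (auto simp: conj_class_def intro!: rev_image_eqI[of \<one>])

lemma card_conj_class_pos: "x \<in> carrier H \<Longrightarrow> card (conj_class H x) > 0"
  using self_in_conj_class finite_conj_class by (metis card_gt_0_iff empty_iff)

text \<open>The elements h that conjugate x to a given c form a coset of the centraliser of x, so
  every c is hit equally often. Averages over h are thus averages over the class.\<close>

lemma sum_conj_class:
  fixes F :: "'a \<Rightarrow> real"
  assumes x: "x \<in> carrier H"
  shows "(\<Sum>c\<in>conj_class H x. F c) =
    card (conj_class H x) * ((\<Sum>h\<in>carrier H. F (h \<otimes> x \<otimes> inv h)) / card (carrier H))"
proof -
  define k where "k = (\<lambda>h. h \<otimes> x \<otimes> inv h)"
  define m where "m c = card {h\<in>carrier H. k h = c}" for c
  have m: "m c = m x" if c: "c \<in> conj_class H x" for c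
  proof -
    obtain g where g: "g \<in> carrier H" "c = g \<otimes> x \<otimes> inv g"
      using c by (auto simp: conj_class_def)
    have *: "inv g \<otimes> h \<otimes> x \<otimes> inv (inv g \<otimes> h) = x" if "h \<in> carrier H" "k h = c" for h
    proof -
      have "inv g \<otimes> h \<otimes> x \<otimes> inv (inv g \<otimes> h) = inv g \<otimes> k h \<otimes> g"
        using that(1) g(1) x by (simp add: k_def m_assoc inv_mult_group)
      also have "\<dots> = inv g \<otimes> (g \<otimes> x \<otimes> inv g) \<otimes> g" using that(2) g(2) by simp
      also have "\<dots> = x" using g x by (simp add: m_assoc)
      finally show ?thesis .
    qed
    have **: "g \<otimes> h \<otimes> x \<otimes> inv (g \<otimes> h) = c" if "h \<in> carrier H" "k h = x" for h
    proof -
      have "g \<otimes> h \<otimes> x \<otimes> inv (g \<otimes> h) = g \<otimes> k h \<otimes> inv g"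
        using that(1) g(1) x by (simp add: k_def m_assoc inv_mult_group)
      then show ?thesis using that g by simp
    qed
    \<comment> \<open>If c is the conjugate of x by g, left multiplication by inv g carries the
      coset belonging to c onto the centraliser.\<close>
    have "bij_betw (\<lambda>h. inv g \<otimes> h) {h\<in>carrier H. k h = c} {h\<in>carrier H. k h = x}"
      using g * **
      by (intro bij_betw_byWitness[where f' = "\<lambda>h. g \<otimes> h"]) (auto simp: k_def)
    then show ?thesis by (simp add: m_def bij_betw_same_card)
  qed
  have grp: "(\<Sum>h\<in>carrier H. F (k h)) = m x * (\<Sum>c\<in>conj_class H x. F c)" for F :: "'a \<Rightarrow> real"
  proof -
    have "(\<Sum>h\<in>carrier H. F (k h)) = (\<Sum>c\<in>conj_class H x. \<Sum>h\<in>{h\<in>carrier H. k h = c}. F (k h))"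
      by (rule sum.group[symmetric]) (auto simp: fin finite_conj_class conj_class_def k_def)
    also have "\<dots> = (\<Sum>c\<in>conj_class H x. m c * F c)"
      by (intro sum.cong refl) (simp add: m_def)
    also have "\<dots> = (\<Sum>c\<in>conj_class H x. m x * F c)"
      using m by (intro sum.cong) auto
    finally show ?thesis by (simp add: sum_distrib_left)
  qed
  \<comment> \<open>The constant function 1 gives the orbit-stabiliser formula, which eliminates the
    multiplicity m x.\<close>
  have eq: "real (card (carrier H)) = m x * card (conj_class H x)"
    using grp[of "\<lambda>_. 1"] by simp
  then have "m x > 0"
    using card_pos by (auto simp: zero_less_mult_iff)
  with eq show ?thesis
    using grp[of F] card_pos card_conj_class_pos[OF x] by (simp add: k_def field_simps)
qed

text \<open>With v the class average of t and e that of the point mass, K v = e / n. Pairing with e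
  averages over the class of x, so N(x) = <v, e> = n <v, K v>, and K^2 \<le> K bounds this below by
  n |K v|^2 = |e|^2 / n. Since e has total mass 1 and lives on the class of x, Cauchy-Schwarz bounds
  |e|^2 below by the reciprocal of the class size.\<close>

lemma diag_weight_lower_bound:
  assumes x: "x \<in> carrier H"
    and t: "\<And>y. y \<in> carrier H \<Longrightarrow> card (carrier H) * comm_op H t y = unit_ind H y"
  shows "diag_weight H t x \<ge> 1 / (card (carrier H) * card (conj_class H x))"
proof -
  define v where "v = class_avg H (inv x) t"
  define e where "e = class_avg H (inv x) (unit_ind H)"
  define n where "n = real (card (carrier H))"
  have n: "n > 0" using card_pos by (simp add: n_def)
  have t': "comm_op H t y = unit_ind H y / n" if "y \<in> carrier H" for y
    using t[OF that] n by (simp add: n_def field_simps)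
  have Kv: "comm_op H v y = e y / n" if y: "y \<in> carrier H" for y
  proof -
    have "comm_op H v y = class_avg H (inv x) (comm_op H t) y"
      unfolding v_def using x y by (intro comm_op_class_avg) auto
    also have "\<dots> = class_avg H (inv x) (\<lambda>z. unit_ind H z / n) y"
      using x y t' by (intro class_avg_cong) auto
    also have "\<dots> = e y / n"
      by (simp add: e_def class_avg_def flip: sum_divide_distrib)
    finally show ?thesis .
  qed
  have e0: "e y = 0" if y: "y \<in> carrier H" "y \<notin> conj_class H x" for y
  proof -
    have "h \<otimes> inv x \<otimes> inv h \<otimes> y \<noteq> \<one>" if h: "h \<in> carrier H" for h
    proof
      assume "h \<otimes> inv x \<otimes> inv h \<otimes> y = \<one>"
      then have "y = inv (h \<otimes> inv x \<otimes> inv h)"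
        using h x y by (metis inv_closed inv_equality inv_inv m_closed)
      also have "\<dots> = h \<otimes> x \<otimes> inv h" using h x by (simp add: inv_mult_group m_assoc)
      finally show False using y h by (auto simp: conj_class_def)
    qed
    then show ?thesis by (simp add: e_def class_avg_def unit_ind_def)
  qed
  have "1 = (\<Sum>y\<in>carrier H. e y)"
    unfolding e_def using x by (subst sum_class_avg) (auto simp: unit_ind_def fin)
  also have "\<dots> = (\<Sum>y\<in>conj_class H x. e y)"
    using conj_class_subset[OF x] e0 by (intro sum.mono_neutral_right) (auto simp: fin)
  finally have s1: "(\<Sum>y\<in>conj_class H x. e y) = 1" ..
  have "1 \<le> (\<Sum>y\<in>conj_class H x. (e y)\<^sup>2) * card (conj_class H x)"
    using sum_squared_le_sum_of_squares[of e "conj_class H x"] s1 by simp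
  also have "(\<Sum>y\<in>conj_class H x. (e y)\<^sup>2) \<le> (\<Sum>y\<in>carrier H. (e y)\<^sup>2)"
    using conj_class_subset[OF x] by (intro sum_mono2) (auto simp: fin)
  finally have e2: "1 / card (conj_class H x) \<le> (\<Sum>y\<in>carrier H. (e y)\<^sup>2)"
    using card_conj_class_pos[OF x] by (simp add: field_simps mult_right_mono)
  have "diag_weight H t x = (\<Sum>y\<in>carrier H. v y * e y)"
    unfolding e_def sum_class_avg_unit[OF x] by (simp add: diag_weight_def v_def)
  also have "\<dots> = n * (\<Sum>y\<in>carrier H. v y * comm_op H v y)"
    using n Kv by (simp add: sum_distrib_left)
  also have "\<dots> \<ge> n * (\<Sum>y\<in>carrier H. (comm_op H v y)\<^sup>2)"
    using n comm_op_le_form by (intro mult_left_mono) auto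
  also have "n * (\<Sum>y\<in>carrier H. (comm_op H v y)\<^sup>2) = (\<Sum>y\<in>carrier H. (e y)\<^sup>2) / n"
    using n Kv by (simp add: sum_distrib_left sum_divide_distrib power2_eq_square)
  finally have "(\<Sum>y\<in>carrier H. (e y)\<^sup>2) / n \<le> diag_weight H t x" .
  moreover have "1 / card (conj_class H x) / n \<le> (\<Sum>y\<in>carrier H. (e y)\<^sup>2) / n"
    using n e2 by (intro divide_right_mono) auto
  ultimately show ?thesis by (simp add: n_def mult.commute)
qed

text \<open>At inv x, the average over h in \<open>diag_weight\<close> is a class average evaluated
  at the identity, so the sum assembles the operator K there. If |H| K t is the point mass at the
  identity, the total mass of N is 1.\<close>

lemma sum_diag_weight:
  "(\<Sum>x\<in>carrier H. diag_weight H t x) = card (carrier H) * comm_op H t \<one>"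
proof -
  have "(\<Sum>x\<in>carrier H. diag_weight H t x) = (\<Sum>x\<in>carrier H. diag_weight H t (inv x))"
    by (rule sum_inv[symmetric])
  also have "\<dots> = (\<Sum>x\<in>carrier H. class_avg H (inv x) (class_avg H x t) \<one>)"
    unfolding diag_weight_def
    by (intro sum.cong refl) (simp add: class_avg_def[of H "inv _"])
  finally show ?thesis using card_pos by (simp add: comm_op_def)
qed

section \<open>Solving for t, and the constant of one nonabelian group\<close>

text \<open>A Neumann series: t is the sum of the powers of 1 - K applied to the point mass, divided
  by |H|. It converges because the two bounds on K make 1 - K shrink squared norms by the factor 1 -
  1 / |H|.\<close>

lemma exists_diagonal:
  "\<exists>t. \<forall>y\<in>carrier H. card (carrier H) * comm_op H t y = unit_ind H y"
proof -
  define n where "n = real (card (carrier H))"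
  have n: "n \<ge> 1" using card_pos by (simp add: n_def)
  define r where "r = rec_nat (unit_ind H) (\<lambda>_ f y. f y - comm_op H f y)"
  have r0: "r 0 = unit_ind H" and rS: "r (Suc m) = (\<lambda>y. r m y - comm_op H (r m) y)" for m
    by (simp_all add: r_def)
  define q where "q = 1 - 1 / n"
  have q: "0 \<le> q" "q < 1" using n by (auto simp: q_def)
  have step: "(\<Sum>y\<in>carrier H. (r (Suc m) y)\<^sup>2) \<le> q * (\<Sum>y\<in>carrier H. (r m y)\<^sup>2)" for m
  proof -
    have "(\<Sum>y\<in>carrier H. (r (Suc m) y)\<^sup>2) = (\<Sum>y\<in>carrier H. (r m y)\<^sup>2)
        - 2 * (\<Sum>y\<in>carrier H. r m y * comm_op H (r m) y) + (\<Sum>y\<in>carrier H. (comm_op H (r m) y)\<^sup>2)"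
      by (simp add: rS power2_diff sum.distrib sum_subtractf sum_distrib_left mult_ac)
    \<comment> \<open>K^2 \<le> K absorbs the quadratic term into one of the two copies of the form;
      coercivity is then applied to the remaining copy.\<close>
    also have "\<dots> \<le> (\<Sum>y\<in>carrier H. (r m y)\<^sup>2) - (\<Sum>y\<in>carrier H. r m y * comm_op H (r m) y)"
      using comm_op_le_form[of "r m"] by simp
    also have "\<dots> \<le> q * (\<Sum>y\<in>carrier H. (r m y)\<^sup>2)"
      using comm_op_coercive[of "r m"] n by (simp add: q_def n_def field_simps)
    finally show ?thesis .
  qed
  have decay: "(\<Sum>y\<in>carrier H. (r m y)\<^sup>2) \<le> q ^ m" for m
  proof (induction m)
    case 0
    have "(\<Sum>y\<in>carrier H. (unit_ind H y)\<^sup>2) = (\<Sum>y\<in>carrier H. unit_ind H y)"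
      by (intro sum.cong) (auto simp: unit_ind_def)
    then show ?case by (simp add: r0 unit_ind_def fin)
  next
    case (Suc m)
    then show ?case using step[of m] q mult_left_mono[OF Suc, of q] by simp
  qed
  have bd: "norm (r m y) \<le> sqrt q ^ m" if y: "y \<in> carrier H" for m y
  proof -
    have "(r m y)\<^sup>2 \<le> (\<Sum>y\<in>carrier H. (r m y)\<^sup>2)"
      using y by (intro member_le_sum) (auto simp: fin)
    then have "(r m y)\<^sup>2 \<le> (sqrt q ^ m)\<^sup>2"
      using decay[of m] q by (simp add: power_mult[symmetric] mult.commute[of m] power_mult)
    then show ?thesis using abs_le_square_iff[of "r m y" "sqrt q ^ m"] q by simp
  qed
  have sq: "sqrt q < 1" using q real_sqrt_less_mono[of q 1] by simp
  have summ: "summable (\<lambda>m. r m y)" if "y \<in> carrier H" for y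
    by (rule summable_comparison_test'[where N = 0 and g = "\<lambda>m. sqrt q ^ m"])
       (use bd[OF that] q sq in auto)
  define t where "t y = (\<Sum>m. r m y)" for y
  have sums_t: "(\<lambda>m. r m y) sums t y" if "y \<in> carrier H" for y
    using summ[OF that] by (simp add: t_def summable_sums)
  have avg_sums: "(\<lambda>m. class_avg H a (f m) y) sums class_avg H a g y"
    if "a \<in> carrier H" "y \<in> carrier H" "\<And>z. z \<in> carrier H \<Longrightarrow> (\<lambda>m. f m z) sums g z" for a f g y
    unfolding class_avg_def using that by (intro sums_divide sums_sum) auto
  have "(\<lambda>m. comm_op H (r m) y) sums comm_op H t y" if "y \<in> carrier H" for y
    unfolding comm_op_def using that by (intro sums_divide sums_sum avg_sums sums_t) auto
  moreover have "(\<lambda>m. comm_op H (r m) y) sums unit_ind H y" if y: "y \<in> carrier H" for y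
  proof -
    \<comment> \<open>By the recursion, K applied to the m-th term is a difference of consecutive
      terms, so the series telescopes to the first one.\<close>
    have "(\<lambda>m. r m y - r (Suc m) y) sums (r 0 y - 0)"
      by (rule telescope_sums'[OF summable_LIMSEQ_zero[OF summ[OF y]]])
    then show ?thesis by (simp add: rS r0)
  qed
  ultimately have K: "comm_op H t y = unit_ind H y" if "y \<in> carrier H" for y
    using that sums_unique2 by blast
  \<comment> \<open>The series solves K t = point mass; the factor |H| is restored by dividing t by
    n.\<close>
  have "card (carrier H) * comm_op H (\<lambda>y. t y / n) y = unit_ind H y" if "y \<in> carrier H" for y
  proof -
    have "comm_op H (\<lambda>y. t y / n) y = comm_op H t y / n"
      by (simp add: comm_op_def class_avg_def flip: sum_divide_distrib)
    then show ?thesis using K[OF that] n by (simp add: n_def)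
  qed
  then show ?thesis by blast
qed

text \<open>W is at least 1 on the centre Z and at least 2 off it. The pointwise bound on N also
  gives W N \<ge> 1 / n everywhere, which matters when N has little mass outside the centre.\<close>

lemma diag_constant_ge:
  assumes nc: "\<not> comm_group H"
    and t: "\<And>y. y \<in> carrier H \<Longrightarrow> card (carrier H) * comm_op H t y = unit_ind H y"
  shows "(\<Sum>x\<in>carrier H. card (conj_class H x) * diag_weight H t x) \<ge> 5 / 4"
proof -
  define n where "n = real (card (carrier H))"
  have n: "n > 0" using card_pos by (simp add: n_def)
  define Z where "Z = {z\<in>carrier H. \<forall>x\<in>carrier H. x \<otimes> z = z \<otimes> x}"
  define N where "N = diag_weight H t"
  define W where "W x = real (card (conj_class H x))" for x
  have Zs: "Z \<subseteq> carrier H" by (auto simp: Z_def)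
  have fZ: "finite Z" using Zs fin finite_subset by blast
  have W1: "W x \<ge> 1" if "x \<in> carrier H" for x
    using card_conj_class_pos[OF that] by (simp add: W_def)
  have Nlow: "N x \<ge> 1 / (n * W x)" if "x \<in> carrier H" for x
    using diag_weight_lower_bound[OF that t] by (simp add: N_def W_def n_def)
  have N0: "N x \<ge> 0" if "x \<in> carrier H" for x
    using Nlow[OF that] W1[OF that] n
    by (smt (verit) divide_nonneg_nonneg mult_nonneg_nonneg)
  have W2: "W x \<ge> 2" if x: "x \<in> carrier H - Z" for x
  proof -
    obtain h where h: "h \<in> carrier H" "h \<otimes> x \<noteq> x \<otimes> h" using x by (auto simp: Z_def)
    have "h \<otimes> x \<otimes> inv h \<noteq> x"
    proof
      assume "h \<otimes> x \<otimes> inv h = x"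
      then have "h \<otimes> x \<otimes> inv h \<otimes> h = x \<otimes> h" by simp
      then show False using h x by (simp add: m_assoc)
    qed
    moreover have "h \<otimes> x \<otimes> inv h \<in> conj_class H x" using h by (auto simp: conj_class_def)
    ultimately have "card {h \<otimes> x \<otimes> inv h, x} = 2" "{h \<otimes> x \<otimes> inv h, x} \<subseteq> conj_class H x"
      using self_in_conj_class x by auto
    then have "card (conj_class H x) \<ge> 2" using finite_conj_class card_mono by metis
    then show ?thesis by (simp add: W_def)
  qed
  have halfZ: "real (card (carrier H - Z)) \<ge> n / 2"
  proof -
    obtain g where g: "g \<in> carrier H" "g \<notin> Z"
    proof -
      have "\<exists>x\<in>carrier H. \<exists>y\<in>carrier H. x \<otimes> y \<noteq> y \<otimes> x"
        using nc group_comm_groupI by blast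
      then show ?thesis using that by (auto simp: Z_def)
    qed
    \<comment> \<open>A noncentral g translates Z into its complement: if g z were central for a
      central z, then so would be g.\<close>
    have "card Z \<le> card (carrier H - Z)"
    proof (rule card_inj_on_le[of "\<lambda>z. g \<otimes> z"])
      show "inj_on (\<lambda>z. g \<otimes> z) Z" using g Zs by (intro inj_onI) (metis inv_mult_cancel(1) subsetD)
      show "(\<lambda>z. g \<otimes> z) ` Z \<subseteq> carrier H - Z"
      proof safe
        fix z assume z: "z \<in> Z"
        then have zc: "z \<in> carrier H" using Zs by auto
        show "g \<otimes> z \<in> carrier H" using g zc by simp
        assume gz: "g \<otimes> z \<in> Z"
        have "x \<otimes> g = g \<otimes> x" if x: "x \<in> carrier H" for x
        proof -
          have "x \<otimes> g \<otimes> z = x \<otimes> (g \<otimes> z)" using g x zc by (simp add: m_assoc)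
          also have "\<dots> = g \<otimes> z \<otimes> x" using gz x by (simp add: Z_def)
          also have "\<dots> = g \<otimes> (z \<otimes> x)" using g(1) x zc by (simp add: m_assoc)
          also have "z \<otimes> x = x \<otimes> z" using z x by (simp add: Z_def)
          also have "g \<otimes> (x \<otimes> z) = g \<otimes> x \<otimes> z" using g x zc by (simp add: m_assoc)
          finally show ?thesis using g x zc by simp
        qed
        then show False using g by (simp add: Z_def)
      qed
    qed (simp add: fin)
    moreover have "card Z + card (carrier H - Z) = card (carrier H)"
      using Zs fin fZ by (metis card_Diff_subset card_mono le_add_diff_inverse)
    ultimately show ?thesis by (simp add: n_def)
  qed
  have sumN: "(\<Sum>x\<in>carrier H. N x) = 1"
    using sum_diag_weight[of t] t[of \<one>] by (simp add: N_def unit_ind_def)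
  define q where "q = (\<Sum>x\<in>carrier H - Z. N x)"
  have split: "(\<Sum>x\<in>carrier H. F x) = (\<Sum>x\<in>carrier H - Z. F x) + (\<Sum>x\<in>Z. F x)" for F :: "'a \<Rightarrow> real"
    using Zs fin by (rule sum.subset_diff)
  have q': "(\<Sum>x\<in>Z. N x) = 1 - q" using sumN split[of N] by (simp add: q_def)
  have "(\<Sum>x\<in>Z. W x * N x) \<ge> (\<Sum>x\<in>Z. N x)"
    using W1 N0 Zs by (intro sum_mono) (metis in_mono mult_le_cancel_right1 not_le)
  moreover have "(\<Sum>x\<in>carrier H - Z. W x * N x) \<ge> 2 * q"
    unfolding q_def sum_distrib_left using W2 N0 by (intro sum_mono mult_right_mono) auto
  moreover have "(\<Sum>x\<in>carrier H - Z. W x * N x) \<ge> 1 / 2"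
  proof -
    have "1 / 2 \<le> real (card (carrier H - Z)) * (1 / n)" using halfZ n by (simp add: field_simps)
    also have "\<dots> = (\<Sum>x\<in>carrier H - Z. 1 / n)" by simp
    also have "\<dots> \<le> (\<Sum>x\<in>carrier H - Z. W x * N x)"
    proof (intro sum_mono)
      fix x assume x: "x \<in> carrier H - Z"
      have "1 / n = W x * (1 / (n * W x))" using W1[of x] x by simp
      also have "\<dots> \<le> W x * N x" using Nlow[of x] W1[of x] x by (intro mult_left_mono) auto
      finally show "1 / n \<le> W x * N x" .
    qed
    finally show ?thesis .
  qed
  \<comment> \<open>The sum is at least (1 - q) + 2 q and at least (1 - q) + 1/2. The mean of these
    two bounds is 5/4 for every q.\<close>
  ultimately show ?thesis
    using split[of "\<lambda>x. W x * N x"] q' by (simp add: W_def N_def)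
qed

section \<open>Limits of approximate diagonals on one finite group\<close>

lemma class_avg_diff:
  "class_avg H a (\<lambda>y. f y - g y) x = class_avg H a f x - class_avg H a g x"
  by (simp add: class_avg_def sum_subtractf diff_divide_distrib)

lemma comm_op_diff:
  "comm_op H (\<lambda>y. f y - g y) x = comm_op H f x - comm_op H g x"
proof -
  have "class_avg H a (\<lambda>y. f y - g y) = (\<lambda>x. class_avg H a f x - class_avg H a g x)" for a f g
    by (simp add: fun_eq_iff class_avg_diff)
  then show ?thesis
    by (simp add: comm_op_def sum_subtractf diff_divide_distrib)
qed

lemma tendsto_class_avg:
  assumes "\<And>y. y \<in> carrier H \<Longrightarrow> ((\<lambda>j. f j y) \<longlongrightarrow> g y) F" "a \<in> carrier H" "x \<in> carrier H"
  shows "((\<lambda>j. class_avg H a (f j) x) \<longlongrightarrow> class_avg H a g x) F"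
  unfolding class_avg_def using assms card_pos by (intro tendsto_divide tendsto_sum tendsto_const) auto

text \<open>The hypotheses on M are what remains of an approximate diagonal after projection:
  centrality in the second variable, the diagonal identity read at second argument 1, and the
  approximate unit condition. They force |H| K (T j) to converge to the point mass, and the lower
  bound on K transfers this to T j, whose class averages govern the whole matrix.\<close>

lemma approx_diagonal_tendsto:
  fixes M :: "'i \<Rightarrow> 'a \<Rightarrow> 'a \<Rightarrow> real"
  assumes t: "\<And>y. y \<in> carrier H \<Longrightarrow> card (carrier H) * comm_op H t y = unit_ind H y"
    and inv: "\<And>j x y h. \<lbrakk>x \<in> carrier H; y \<in> carrier H; h \<in> carrier H\<rbrakk> \<Longrightarrow>
      M j x (h \<otimes> y \<otimes> inv h) = M j x y"
    and diag: "\<And>x y. \<lbrakk>x \<in> carrier H; y \<in> carrier H\<rbrakk> \<Longrightarrow>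
      ((\<lambda>j. class_avg H y (\<lambda>z. M j z \<one>) x - M j x y) \<longlongrightarrow> 0) F"
    and unit: "\<And>x. x \<in> carrier H \<Longrightarrow>
      ((\<lambda>j. \<Sum>u\<in>carrier H. M j u (inv u \<otimes> x)) \<longlongrightarrow> unit_ind H x) F"
    and x: "x \<in> carrier H" and y: "y \<in> carrier H"
  shows "((\<lambda>j. M j x y) \<longlongrightarrow> class_avg H y t x) F"
proof -
  define n where "n = real (card (carrier H))"
  have n: "n > 0" using card_pos by (simp add: n_def)
  define T where "T j z = M j z \<one>" for j z
  \<comment> \<open>Invariance in the second argument allows conjugating it together with the class
    element in the first. Reindexing a then removes h altogether.\<close>
  have conv: "(\<Sum>a\<in>carrier H. class_avg H (inv a) (\<lambda>z. M j z a) x) =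
      (\<Sum>u\<in>carrier H. M j u (inv u \<otimes> x))" if x: "x \<in> carrier H" for j x
  proof -
    have "(\<Sum>a\<in>carrier H. class_avg H (inv a) (\<lambda>z. M j z a) x) =
        (\<Sum>a\<in>carrier H. \<Sum>h\<in>carrier H. M j (inv (h \<otimes> a \<otimes> inv h) \<otimes> x) (h \<otimes> a \<otimes> inv h)) / n"
      unfolding class_avg_def n_def sum_divide_distrib[symmetric]
      using x inv by (intro arg_cong[of _ _ "\<lambda>s. s / real (card (carrier H))"] sum.cong refl)
        (simp add: inv_mult_group m_assoc)
    also have "\<dots> = (\<Sum>h\<in>carrier H. \<Sum>a\<in>carrier H. M j (inv (h \<otimes> a \<otimes> inv h) \<otimes> x) (h \<otimes> a \<otimes> inv h)) / n"
      by (subst sum.swap) simp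
    also have "\<dots> = (\<Sum>h\<in>carrier H. \<Sum>a\<in>carrier H. M j (inv a \<otimes> x) a) / n"
    proof (rule arg_cong[of _ _ "\<lambda>s. s / n"], rule sum.cong[OF refl])
      fix h assume h: "h \<in> carrier H"
      show "(\<Sum>a\<in>carrier H. M j (inv (h \<otimes> a \<otimes> inv h) \<otimes> x) (h \<otimes> a \<otimes> inv h)) =
            (\<Sum>a\<in>carrier H. M j (inv a \<otimes> x) a)"
        using h by (intro sum.reindex_bij_witness[of _ "\<lambda>a. inv h \<otimes> a \<otimes> h" "\<lambda>a. h \<otimes> a \<otimes> inv h"])
           (auto simp: m_assoc)
    qed
    also have "\<dots> = (\<Sum>a\<in>carrier H. M j (inv a \<otimes> x) a)"
      using n by (simp add: n_def)
    \<comment> \<open>The substitution a = x u^-1 puts the sum in convolution form up to the order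
      of the factors; conjugating x u^-1 by u^-1 gives u^-1 x, and M does not see the
      conjugation.\<close>
    also have "\<dots> = (\<Sum>u\<in>carrier H. M j u (x \<otimes> inv u))"
      using x by (intro sum.reindex_bij_witness[of _ "\<lambda>u. x \<otimes> inv u" "\<lambda>a. inv a \<otimes> x"])
        (auto simp: m_assoc inv_mult_group)
    also have "\<dots> = (\<Sum>u\<in>carrier H. M j u (inv u \<otimes> x))"
    proof (rule sum.cong[OF refl])
      fix u assume u: "u \<in> carrier H"
      have "M j u (x \<otimes> inv u) = M j u (u \<otimes> (inv u \<otimes> x) \<otimes> inv u)"
        using u x by (simp add: m_assoc)
      also have "\<dots> = M j u (inv u \<otimes> x)" using u x by (intro inv) auto
      finally show "M j u (x \<otimes> inv u) = M j u (inv u \<otimes> x)" .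
    qed
    finally show ?thesis .
  qed
  \<comment> \<open>Averaging the diagonal identity at a by the class of a and summing over a gives
    n K (T j) on one side and the projected multiplication map on the other.\<close>
  have K0: "((\<lambda>j. n * comm_op H (\<lambda>z. T j z - t z) x) \<longlongrightarrow> 0) F" if x: "x \<in> carrier H" for x
  proof -
    have "((\<lambda>j. \<Sum>a\<in>carrier H. class_avg H (inv a) (\<lambda>z. class_avg H a (T j) z - M j z a) x)
        \<longlongrightarrow> (\<Sum>a\<in>carrier H. class_avg H (inv a) (\<lambda>z. 0) x)) F"
      unfolding T_def using x diag by (intro tendsto_sum tendsto_class_avg) auto
    moreover have "class_avg H a (\<lambda>z. 0) x = 0" for a by (simp add: class_avg_def)
    ultimately have "((\<lambda>j. (\<Sum>a\<in>carrier H. class_avg H (inv a) (class_avg H a (T j)) x) -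
        (\<Sum>u\<in>carrier H. M j u (inv u \<otimes> x))) \<longlongrightarrow> 0) F"
      using conv[OF x] by (simp add: class_avg_diff sum_subtractf)
    from tendsto_add[OF this unit[OF x]]
    have "((\<lambda>j. n * comm_op H (T j) x) \<longlongrightarrow> unit_ind H x) F"
      using n by (simp add: comm_op_def n_def)
    from tendsto_diff[OF this tendsto_const[of "n * comm_op H t x"]]
    show ?thesis using t[OF x] by (simp add: comm_op_diff right_diff_distrib n_def)
  qed
  have "((\<lambda>j. \<Sum>x\<in>carrier H. (n * comm_op H (\<lambda>z. T j z - t z) x)\<^sup>2) \<longlongrightarrow> (\<Sum>x\<in>carrier H. 0\<^sup>2)) F"
    by (intro tendsto_sum tendsto_power K0)
  then have sq0: "((\<lambda>j. \<Sum>x\<in>carrier H. (n * comm_op H (\<lambda>z. T j z - t z) x)\<^sup>2) \<longlongrightarrow> 0) F"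
    by simp
  have Tt: "((\<lambda>j. T j z) \<longlongrightarrow> t z) F" if z: "z \<in> carrier H" for z
  proof -
    have le: "(T j z - t z)\<^sup>2 \<le> (\<Sum>x\<in>carrier H. (n * comm_op H (\<lambda>z. T j z - t z) x)\<^sup>2)" for j
    proof -
      have "(T j z - t z)\<^sup>2 \<le> (\<Sum>x\<in>carrier H. (T j x - t x)\<^sup>2)"
        using z by (intro member_le_sum) (auto simp: fin)
      also have "\<dots> \<le> (\<Sum>x\<in>carrier H. (n * comm_op H (\<lambda>z. T j z - t z) x)\<^sup>2)"
        unfolding n_def by (rule comm_op_bounded_below)
      finally show ?thesis .
    qed
    have "((\<lambda>j. (T j z - t z)\<^sup>2) \<longlongrightarrow> 0) F"
      by (rule tendsto_sandwich[OF _ _ tendsto_const sq0]) (auto simp: le)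
    from tendsto_real_sqrt[OF this] have "((\<lambda>j. \<bar>T j z - t z\<bar>) \<longlongrightarrow> 0) F" by simp
    then have "((\<lambda>j. T j z - t z) \<longlongrightarrow> 0) F" by (simp add: tendsto_rabs_zero_iff)
    then show ?thesis by (simp add: LIM_zero_iff)
  qed
  have "((\<lambda>j. class_avg H y (T j) x) \<longlongrightarrow> class_avg H y t x) F"
    using x y Tt by (intro tendsto_class_avg) auto
  from tendsto_diff[OF this diag[OF x y, folded T_def]] show ?thesis
    by simp
qed

text \<open>The tested entries are those at (c, y^-1) with c conjugate to y. In the limit, summing
  over c produces the class size times an average over conjugates, which is
  \<open>diag_weight\<close>.\<close>

lemma diag_constant_le_bound:
  fixes M :: "'i \<Rightarrow> 'a \<Rightarrow> 'a \<Rightarrow> real"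
  assumes F: "F \<noteq> bot"
    and lim: "\<And>x y. \<lbrakk>x \<in> carrier H; y \<in> carrier H\<rbrakk> \<Longrightarrow> ((\<lambda>j. M j x y) \<longlongrightarrow> class_avg H y t x) F"
    and bound: "\<And>j. (\<Sum>y\<in>carrier H. \<Sum>c\<in>conj_class H y. M j c (inv y)) \<le> B"
  shows "(\<Sum>x\<in>carrier H. card (conj_class H x) * diag_weight H t x) \<le> B"
proof -
  have "((\<lambda>j. \<Sum>y\<in>carrier H. \<Sum>c\<in>conj_class H y. M j c (inv y)) \<longlongrightarrow>
     (\<Sum>y\<in>carrier H. \<Sum>c\<in>conj_class H y. class_avg H (inv y) t c)) F"
    using conj_class_subset by (intro tendsto_sum lim) auto
  also have "(\<Sum>y\<in>carrier H. \<Sum>c\<in>conj_class H y. class_avg H (inv y) t c) =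
      (\<Sum>x\<in>carrier H. card (conj_class H x) * diag_weight H t x)"
    by (simp add: sum_conj_class diag_weight_def)
  finally show ?thesis
    using bound by (intro tendsto_upperbound[OF _ _ F]) auto
qed

end

section \<open>Finite products of groups, where every quantity factorises\<close>

locale fin_group_family =
  fixes I :: "'i set" and G :: "'i \<Rightarrow> 'a monoid"
  assumes fin_I: "finite I"
    and grp: "\<And>i. group (G i)"
    and fin_G: "\<And>i. finite (carrier (G i))"
begin

abbreviation "P \<equiv> product_group I G"

sublocale P: fin_group P
  by (simp add: fin_group_def fin_group_axioms_def grp fin_I fin_G finite_PiE)

lemma fin_group_component: "fin_group (G i)"
  by (simp add: fin_group_def fin_group_axioms_def grp fin_G)

lemma card_P: "card (carrier P) = (\<Prod>i\<in>I. card (carrier (G i)))"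
  by (simp add: card_PiE fin_I)

text \<open>Conjugation acts coordinatewise, so for a product function the sum over h splits by
  distributivity. The factorisations of \<open>comm_op\<close> and \<open>diag_weight\<close> rest
  on the same exchange of sum and product.\<close>

lemma class_avg_product:
  assumes a: "a \<in> carrier P" and x: "x \<in> carrier P"
  shows "class_avg P a (\<lambda>x. \<Prod>i\<in>I. f i (x i)) x = (\<Prod>i\<in>I. class_avg (G i) (a i) (f i) (x i))"
proof -
  have "(\<Sum>h\<in>carrier P. \<Prod>i\<in>I. f i ((h \<otimes>\<^bsub>P\<^esub> a \<otimes>\<^bsub>P\<^esub> inv\<^bsub>P\<^esub> h \<otimes>\<^bsub>P\<^esub> x) i)) =
      (\<Sum>h\<in>carrier P. \<Prod>i\<in>I. f i (h i \<otimes>\<^bsub>G i\<^esub> a i \<otimes>\<^bsub>G i\<^esub> inv\<^bsub>G i\<^esub> h i \<otimes>\<^bsub>G i\<^esub> x i))"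
    by (intro sum.cong prod.cong refl) (simp_all add: grp)
  also have "\<dots> = (\<Prod>i\<in>I. \<Sum>h\<in>carrier (G i). f i (h \<otimes>\<^bsub>G i\<^esub> a i \<otimes>\<^bsub>G i\<^esub> inv\<^bsub>G i\<^esub> h \<otimes>\<^bsub>G i\<^esub> x i))"
    using fin_I fin_G by (simp add: prod_sum_PiE)
  finally show ?thesis
    by (simp add: class_avg_def card_P prod_dividef del: carrier_product_group)
qed

lemma comm_op_product:
  assumes x: "x \<in> carrier P"
  shows "comm_op P (\<lambda>x. \<Prod>i\<in>I. f i (x i)) x = (\<Prod>i\<in>I. comm_op (G i) (f i) (x i))"
proof -
  have "class_avg P (inv\<^bsub>P\<^esub> a) (class_avg P a (\<lambda>x. \<Prod>i\<in>I. f i (x i))) x =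
      (\<Prod>i\<in>I. class_avg (G i) (inv\<^bsub>G i\<^esub> a i) (class_avg (G i) (a i) (f i)) (x i))"
    if a: "a \<in> carrier P" for a
  proof -
    have ia: "inv\<^bsub>P\<^esub> a \<in> carrier P" using a by (rule P.inv_closed)
    have "class_avg P (inv\<^bsub>P\<^esub> a) (class_avg P a (\<lambda>x. \<Prod>i\<in>I. f i (x i))) x =
      class_avg P (inv\<^bsub>P\<^esub> a) (\<lambda>x. \<Prod>i\<in>I. class_avg (G i) (a i) (f i) (x i)) x"
      using ia x a by (intro P.class_avg_cong class_avg_product)
    also have "\<dots> = (\<Prod>i\<in>I. class_avg (G i) ((inv\<^bsub>P\<^esub> a) i) (class_avg (G i) (a i) (f i)) (x i))"
      using ia x by (rule class_avg_product)
    also have "\<dots> = (\<Prod>i\<in>I. class_avg (G i) (inv\<^bsub>G i\<^esub> a i) (class_avg (G i) (a i) (f i)) (x i))"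
      using a by (intro prod.cong refl) (simp add: grp)
    finally show ?thesis .
  qed
  then have "(\<Sum>a\<in>carrier P. class_avg P (inv\<^bsub>P\<^esub> a) (class_avg P a (\<lambda>x. \<Prod>i\<in>I. f i (x i))) x) =
     (\<Sum>a\<in>carrier P. \<Prod>i\<in>I. class_avg (G i) (inv\<^bsub>G i\<^esub> a i) (class_avg (G i) (a i) (f i)) (x i))"
    by (intro sum.cong refl)
  also have "\<dots> = (\<Prod>i\<in>I. \<Sum>a\<in>carrier (G i). class_avg (G i) (inv\<^bsub>G i\<^esub> a) (class_avg (G i) a (f i)) (x i))"
    using fin_I fin_G by (simp add: prod_sum_PiE)
  finally show ?thesis
    by (simp add: comm_op_def card_P prod_dividef del: carrier_product_group)
qed

lemma unit_ind_product:
  assumes x: "x \<in> carrier P"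
  shows "unit_ind P x = (\<Prod>i\<in>I. unit_ind (G i) (x i))"
proof (cases "x = \<one>\<^bsub>P\<^esub>")
  case True
  then have "unit_ind (G i) (x i) = 1" if "i \<in> I" for i
    using that by (simp add: unit_ind_def)
  then show ?thesis using True by (simp add: unit_ind_def[of P])
next
  case False
  then have "\<exists>i\<in>I. x i \<noteq> \<one>\<^bsub>G i\<^esub>"
    using x by (simp add: PiE_iff extensional_def fun_eq_iff) metis
  then have "\<exists>i\<in>I. unit_ind (G i) (x i) = 0" by (auto simp: unit_ind_def)
  then have "(\<Prod>i\<in>I. unit_ind (G i) (x i)) = 0" using fin_I by (rule prod_zero[rotated])
  then show ?thesis using False by (simp only: unit_ind_def[of P] if_False)
qed

lemma diag_weight_product:
  assumes x: "x \<in> carrier P"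
  shows "diag_weight P (\<lambda>x. \<Prod>i\<in>I. f i (x i)) x = (\<Prod>i\<in>I. diag_weight (G i) (f i) (x i))"
proof -
  have "class_avg P (inv\<^bsub>P\<^esub> x) (\<lambda>x. \<Prod>i\<in>I. f i (x i)) (h \<otimes>\<^bsub>P\<^esub> x \<otimes>\<^bsub>P\<^esub> inv\<^bsub>P\<^esub> h) =
     (\<Prod>i\<in>I. class_avg (G i) (inv\<^bsub>G i\<^esub> x i) (f i) (h i \<otimes>\<^bsub>G i\<^esub> x i \<otimes>\<^bsub>G i\<^esub> inv\<^bsub>G i\<^esub> h i))"
    if h: "h \<in> carrier P" for h
  proof -
    have "class_avg P (inv\<^bsub>P\<^esub> x) (\<lambda>x. \<Prod>i\<in>I. f i (x i)) (h \<otimes>\<^bsub>P\<^esub> x \<otimes>\<^bsub>P\<^esub> inv\<^bsub>P\<^esub> h) =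
      (\<Prod>i\<in>I. class_avg (G i) ((inv\<^bsub>P\<^esub> x) i) (f i) ((h \<otimes>\<^bsub>P\<^esub> x \<otimes>\<^bsub>P\<^esub> inv\<^bsub>P\<^esub> h) i))"
      using x h by (intro class_avg_product P.inv_closed P.m_closed)
    also have "\<dots> = (\<Prod>i\<in>I. class_avg (G i) (inv\<^bsub>G i\<^esub> x i) (f i) (h i \<otimes>\<^bsub>G i\<^esub> x i \<otimes>\<^bsub>G i\<^esub> inv\<^bsub>G i\<^esub> h i))"
      using x h by (intro prod.cong refl) (simp add: grp)
    finally show ?thesis .
  qed
  then have "diag_weight P (\<lambda>x. \<Prod>i\<in>I. f i (x i)) x =
     (\<Sum>h\<in>carrier P. \<Prod>i\<in>I. class_avg (G i) (inv\<^bsub>G i\<^esub> x i) (f i) (h i \<otimes>\<^bsub>G i\<^esub> x i \<otimes>\<^bsub>G i\<^esub> inv\<^bsub>G i\<^esub> h i))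
      / card (carrier P)"
    unfolding diag_weight_def by (intro arg_cong2[of _ _ _ _ "(/)"] sum.cong refl)
  also have "\<dots> = (\<Prod>i\<in>I. \<Sum>h\<in>carrier (G i). class_avg (G i) (inv\<^bsub>G i\<^esub> x i) (f i) (h \<otimes>\<^bsub>G i\<^esub> x i \<otimes>\<^bsub>G i\<^esub> inv\<^bsub>G i\<^esub> h))
      / card (carrier P)"
    using fin_I fin_G by (simp add: prod_sum_PiE)
  finally show ?thesis
    by (simp add: diag_weight_def card_P prod_dividef del: carrier_product_group)
qed

lemma conj_class_product:
  assumes x: "x \<in> carrier P"
  shows "conj_class P x = (\<Pi>\<^sub>E i\<in>I. conj_class (G i) (x i))"
proof (intro subset_antisym subsetI)
  fix y assume "y \<in> conj_class P x"
  then show "y \<in> (\<Pi>\<^sub>E i\<in>I. conj_class (G i) (x i))"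
    by (auto simp: conj_class_def grp)
next
  fix y assume y: "y \<in> (\<Pi>\<^sub>E i\<in>I. conj_class (G i) (x i))"
  then have "\<forall>i\<in>I. \<exists>h\<in>carrier (G i). y i = h \<otimes>\<^bsub>G i\<^esub> x i \<otimes>\<^bsub>G i\<^esub> inv\<^bsub>G i\<^esub> h"
    by (auto simp: conj_class_def PiE_iff)
  then obtain h where h: "\<And>i. i \<in> I \<Longrightarrow> h i \<in> carrier (G i) \<and> y i = h i \<otimes>\<^bsub>G i\<^esub> x i \<otimes>\<^bsub>G i\<^esub> inv\<^bsub>G i\<^esub> h i"
    by metis
  have hP: "restrict h I \<in> carrier P" using h by auto
  have "y = restrict h I \<otimes>\<^bsub>P\<^esub> x \<otimes>\<^bsub>P\<^esub> inv\<^bsub>P\<^esub> restrict h I"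
  proof
    fix i show "y i = (restrict h I \<otimes>\<^bsub>P\<^esub> x \<otimes>\<^bsub>P\<^esub> inv\<^bsub>P\<^esub> restrict h I) i"
    proof (cases "i \<in> I")
      case True
      have "inv\<^bsub>P\<^esub> restrict h I = (\<lambda>i\<in>I. inv\<^bsub>G i\<^esub> restrict h I i)"
        using hP by (intro inv_product_group grp) simp
      then show ?thesis using True h[OF True] by simp
    next
      case False
      then show ?thesis using PiE_arb[OF y False] by simp
    qed
  qed
  then show "y \<in> conj_class P x"
    using hP unfolding conj_class_def by blast
qed

lemma diag_constant_product:
  "(\<Sum>x\<in>carrier P. card (conj_class P x) * diag_weight P (\<lambda>x. \<Prod>i\<in>I. f i (x i)) x) =
   (\<Prod>i\<in>I. \<Sum>x\<in>carrier (G i). card (conj_class (G i) x) * diag_weight (G i) (f i) x)"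
proof -
  have "(\<Sum>x\<in>carrier P. card (conj_class P x) * diag_weight P (\<lambda>x. \<Prod>i\<in>I. f i (x i)) x) =
    (\<Sum>x\<in>carrier P. \<Prod>i\<in>I. card (conj_class (G i) (x i)) * diag_weight (G i) (f i) (x i))"
    by (rule sum.cong[OF refl], subst diag_weight_product, assumption, subst conj_class_product, assumption)
      (simp add: card_PiE[OF fin_I] prod.distrib)
  then show ?thesis using fin_I fin_G by (simp add: prod_sum_PiE)
qed

text \<open>The product of solutions of the factors solves the equation of the product group, since
  both sides factorise. Its constant is then a product of numbers that are each at least
  5/4.\<close>

lemma exists_product_diagonal:
  assumes "\<And>i. \<not> comm_group (G i)"
  shows "\<exists>t. (\<forall>y\<in>carrier P. card (carrier P) * comm_op P t y = unit_ind P y) \<and>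
     (\<Sum>x\<in>carrier P. card (conj_class P x) * diag_weight P t x) \<ge> (5 / 4) ^ card I"
proof -
  obtain f where f: "\<And>i y. y \<in> carrier (G i) \<Longrightarrow>
      card (carrier (G i)) * comm_op (G i) (f i) y = unit_ind (G i) y"
    using fin_group.exists_diagonal[OF fin_group_component] by metis
  let ?t = "\<lambda>x. \<Prod>i\<in>I. f i (x i)"
  have "card (carrier P) * comm_op P ?t y = unit_ind P y" if y: "y \<in> carrier P" for y
  proof -
    have "card (carrier P) * comm_op P ?t y = (\<Prod>i\<in>I. card (carrier (G i)) * comm_op (G i) (f i) (y i))"
      using y by (subst comm_op_product) (simp_all add: card_P prod.distrib del: carrier_product_group)
    also have "\<dots> = (\<Prod>i\<in>I. unit_ind (G i) (y i))"
      using y f by (intro prod.cong) auto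
    finally show ?thesis by (simp only: unit_ind_product[OF y])
  qed
  moreover have "(\<Prod>i\<in>I. 5 / 4) \<le>
      (\<Prod>i\<in>I. \<Sum>x\<in>carrier (G i). card (conj_class (G i) x) * diag_weight (G i) (f i) x)"
    using fin_group.diag_constant_ge[OF fin_group_component assms f] by (intro prod_mono) auto
  ultimately show ?thesis
    by (intro exI[of _ ?t]) (simp only: diag_constant_product prod_constant, blast)
qed

end

section \<open>Haar measure and cylinder functions\<close>

locale fin_group_seq =
  fixes G :: "nat \<Rightarrow> 'a monoid" and n :: nat
  assumes grp: "\<And>i. group (G i)"
    and fin_G: "\<And>i. finite (carrier (G i))"
begin

sublocale fin_group_family "{..<n}" G
  by (simp add: fin_group_family_def grp fin_G)

abbreviation "U \<equiv> product_group UNIV G"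
abbreviation "Q \<equiv> haar G"
abbreviation "ucm i \<equiv> uniform_count_measure (carrier (G i))"

lemma carrier_G_nonempty: "carrier (G i) \<noteq> {}"
  using grp[of i] group.is_monoid monoid.one_closed by fastforce

lemma prob_space_ucm: "prob_space (ucm i)"
  by (intro prob_space_uniform_count_measure fin_G carrier_G_nonempty)

lemma product_prob_space_ucm: "product_prob_space ucm"
  unfolding product_prob_space_def product_prob_space_axioms_def product_sigma_finite_def
  using prob_space_ucm prob_space_imp_sigma_finite by blast

sublocale Q: product_prob_space ucm UNIV
  by (rule product_prob_space_ucm)

sublocale PQ: prob_space Q
  unfolding haar_def by (rule Q.P.prob_space_axioms)

sublocale QQ: pair_sigma_finite Q Q ..

lemma group_U: "group U"
  by (simp add: grp)

sublocale U: group U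
  by (rule group_U)

lemma space_Q: "space Q = carrier U"
  by (simp add: haar_def space_PiM space_uniform_count_measure)

lemma sets_ucm_eq: "sets (ucm i) = sets (count_space (carrier (G i)))"
  by (simp add: sets_uniform_count_measure)

lemma measurable_coord: "(\<lambda>x. x i) \<in> Q \<rightarrow>\<^sub>M count_space (carrier (G i))"
  unfolding haar_def measurable_cong_sets[OF refl sets_ucm_eq[symmetric]]
  by measurable

lemma measurable_into_Q:
  assumes "\<And>i. (\<lambda>x. f x i) \<in> N \<rightarrow>\<^sub>M count_space (carrier (G i))"
  shows "f \<in> N \<rightarrow>\<^sub>M Q"
  unfolding haar_def
proof (rule measurable_PiM_single')
  show "(\<lambda>x. f x i) \<in> N \<rightarrow>\<^sub>M ucm i" for i
    unfolding measurable_cong_sets[OF refl sets_ucm_eq] by (rule assms)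
  show "(\<lambda>\<omega> i. f \<omega> i) \<in> space N \<rightarrow> (\<Pi>\<^sub>E i\<in>UNIV. space (ucm i))"
    using assms[THEN measurable_space] by (auto simp: space_uniform_count_measure)
qed

lemma measurable_coordwise:
  assumes "\<And>i c. c \<in> carrier (G i) \<Longrightarrow> p i c \<in> carrier (G i)"
  shows "(\<lambda>x i. p i (x i)) \<in> Q \<rightarrow>\<^sub>M Q"
  by (rule measurable_into_Q, rule measurable_compose[OF measurable_coord])
     (use assms in auto)

text \<open>It suffices to look at one coordinate, where the first argument takes finitely many
  values. For each fixed value the quotient depends on a single discrete coordinate of the second
  argument.\<close>

lemma measurable_div: "(\<lambda>q. inv\<^bsub>U\<^esub> (fst q) \<otimes>\<^bsub>U\<^esub> snd q) \<in> Q \<Otimes>\<^sub>M Q \<rightarrow>\<^sub>M Q"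
proof -
  have "(\<lambda>q i. inv\<^bsub>G i\<^esub> (fst q i) \<otimes>\<^bsub>G i\<^esub> snd q i) \<in> Q \<Otimes>\<^sub>M Q \<rightarrow>\<^sub>M Q"
  proof (rule measurable_into_Q)
    fix i
    interpret Gi: group "G i" by (rule grp)
    show "(\<lambda>q. inv\<^bsub>G i\<^esub> (fst q i) \<otimes>\<^bsub>G i\<^esub> snd q i) \<in> Q \<Otimes>\<^sub>M Q \<rightarrow>\<^sub>M count_space (carrier (G i))"
    proof (rule measurable_compose_countable'[where g = "\<lambda>q. fst q i" and I = "carrier (G i)"
          and f = "\<lambda>c q. inv\<^bsub>G i\<^esub> c \<otimes>\<^bsub>G i\<^esub> snd q i"])
      fix c assume c: "c \<in> carrier (G i)"
      show "(\<lambda>q. inv\<^bsub>G i\<^esub> c \<otimes>\<^bsub>G i\<^esub> snd q i) \<in> Q \<Otimes>\<^sub>M Q \<rightarrow>\<^sub>M count_space (carrier (G i))"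
        by (rule measurable_compose[OF measurable_compose[OF measurable_snd measurable_coord]])
           (use c in auto)
    next
      show "(\<lambda>q. fst q i) \<in> Q \<Otimes>\<^sub>M Q \<rightarrow>\<^sub>M count_space (carrier (G i))"
        by (rule measurable_compose[OF measurable_fst measurable_coord])
    qed (simp add: fin_G countable_finite)
  qed
  also have "(\<lambda>q i. inv\<^bsub>G i\<^esub> (fst q i) \<otimes>\<^bsub>G i\<^esub> snd q i) \<in> Q \<Otimes>\<^sub>M Q \<rightarrow>\<^sub>M Q \<longleftrightarrow> ?thesis"
    by (rule measurable_cong) (auto simp: space_pair_measure space_Q grp fun_eq_iff)
  finally show ?thesis .
qed

text \<open>A bijection of a finite factor preserves its uniform measure, and a product measure is
  determined on cylinders. Left translation and the map sending x to z x^-1 are both covered, so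
  invariance of Haar measure under translation and inversion comes from one argument.\<close>

lemma distr_coordwise:
  assumes bij: "\<And>i. bij_betw (p i) (carrier (G i)) (carrier (G i))"
  shows "distr Q Q (\<lambda>x i. p i (x i)) = Q"
proof -
  have pc: "p i c \<in> carrier (G i)" if "c \<in> carrier (G i)" for i c
    using bij_betwE[OF bij] that by auto
  have "distr Q Q (\<lambda>x i. p i (x i)) = PiM UNIV ucm"
  proof (rule Q.PiM_eq)
    show "sets (distr Q Q (\<lambda>x i. p i (x i))) = sets (PiM UNIV ucm)"
      by (simp add: haar_def)
    fix J F assume J: "finite J" "J \<subseteq> (UNIV :: nat set)" and F: "\<And>j. j \<in> J \<Longrightarrow> F j \<in> sets (ucm j)"
    define E where "E j = {c \<in> carrier (G j). p j c \<in> F j}" for j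
    have Fs: "F j \<subseteq> carrier (G j)" if "j \<in> J" for j
      using F[OF that] by (auto simp: sets_uniform_count_measure)
    have "emeasure (distr Q Q (\<lambda>x i. p i (x i))) (prod_emb UNIV ucm J (Pi\<^sub>E J F)) =
       emeasure Q ((\<lambda>x i. p i (x i)) -` prod_emb UNIV ucm J (Pi\<^sub>E J F) \<inter> space Q)"
      using J F by (intro emeasure_distr measurable_coordwise pc) (auto simp: haar_def intro!: sets_PiM_I)
    also have "(\<lambda>x i. p i (x i)) -` prod_emb UNIV ucm J (Pi\<^sub>E J F) \<inter> space Q = prod_emb UNIV ucm J (Pi\<^sub>E J E)"
      using pc by (auto simp: prod_emb_def space_Q PiE_iff E_def space_uniform_count_measure)
    also have "emeasure Q \<dots> = (\<Prod>j\<in>J. emeasure (ucm j) (E j))"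
      unfolding haar_def using J
      by (intro Q.emeasure_PiM_emb) (auto simp: sets_uniform_count_measure E_def)
    also have "\<dots> = (\<Prod>j\<in>J. emeasure (ucm j) (F j))"
    proof (rule prod.cong[OF refl])
      fix j assume j: "j \<in> J"
      have "p j ` E j = F j"
        using Fs[OF j] bij_betw_imp_surj_on[OF bij[of j]] by (auto simp: E_def)
      then have "bij_betw (p j) (E j) (F j)"
        using bij_betw_subset[OF bij[of j], of "E j"] by (auto simp: E_def)
      then have "card (E j) = card (F j)" by (rule bij_betw_same_card)
      then show "emeasure (ucm j) (E j) = emeasure (ucm j) (F j)"
        using Fs[OF j] fin_G[of j] by (simp add: emeasure_uniform_count_measure E_def)
    qed
    finally show "emeasure (distr Q Q (\<lambda>x i. p i (x i))) (prod_emb UNIV ucm J (Pi\<^sub>E J F)) =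
       (\<Prod>j\<in>J. emeasure (ucm j) (F j))" .
  qed
  then show ?thesis by (simp add: haar_def)
qed

lemma
  assumes z: "z \<in> carrier U"
  shows measurable_lmult: "(\<lambda>x. z \<otimes>\<^bsub>U\<^esub> x) \<in> Q \<rightarrow>\<^sub>M Q"
    and measurable_ldiv: "(\<lambda>x. z \<otimes>\<^bsub>U\<^esub> inv\<^bsub>U\<^esub> x) \<in> Q \<rightarrow>\<^sub>M Q"
    and distr_lmult: "distr Q Q (\<lambda>x. z \<otimes>\<^bsub>U\<^esub> x) = Q"
    and distr_ldiv: "distr Q Q (\<lambda>x. z \<otimes>\<^bsub>U\<^esub> inv\<^bsub>U\<^esub> x) = Q"
proof -
  have bij1: "bij_betw (\<lambda>c. z i \<otimes>\<^bsub>G i\<^esub> c) (carrier (G i)) (carrier (G i))" for i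
  proof -
    interpret Gi: fin_group "G i" by (rule fin_group_component)
    have "z i \<in> carrier (G i)" using z by auto
    then show ?thesis
      by (intro bij_betw_byWitness[where f' = "\<lambda>c. inv\<^bsub>G i\<^esub> z i \<otimes>\<^bsub>G i\<^esub> c"]) auto
  qed
  have bij2: "bij_betw (\<lambda>c. z i \<otimes>\<^bsub>G i\<^esub> inv\<^bsub>G i\<^esub> c) (carrier (G i)) (carrier (G i))" for i
  proof -
    interpret Gi: fin_group "G i" by (rule fin_group_component)
    have "z i \<in> carrier (G i)" using z by auto
    then show ?thesis
      by (intro bij_betw_byWitness[where f' = "\<lambda>c. inv\<^bsub>G i\<^esub> c \<otimes>\<^bsub>G i\<^esub> z i"])
         (auto simp: Gi.inv_mult_group Gi.m_assoc)
  qed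
  have eq1: "z \<otimes>\<^bsub>U\<^esub> x = (\<lambda>i. z i \<otimes>\<^bsub>G i\<^esub> x i)" for x
    by (simp add: fun_eq_iff)
  have eq2: "z \<otimes>\<^bsub>U\<^esub> inv\<^bsub>U\<^esub> x = (\<lambda>i. z i \<otimes>\<^bsub>G i\<^esub> inv\<^bsub>G i\<^esub> x i)" if "x \<in> space Q" for x
    using that by (simp add: space_Q grp fun_eq_iff)
  show "(\<lambda>x. z \<otimes>\<^bsub>U\<^esub> x) \<in> Q \<rightarrow>\<^sub>M Q"
    unfolding eq1 using bij_betwE[OF bij1] by (intro measurable_coordwise) auto
  show "distr Q Q (\<lambda>x. z \<otimes>\<^bsub>U\<^esub> x) = Q"
    unfolding eq1 by (rule distr_coordwise[OF bij1])
  show "(\<lambda>x. z \<otimes>\<^bsub>U\<^esub> inv\<^bsub>U\<^esub> x) \<in> Q \<rightarrow>\<^sub>M Q"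
    using bij_betwE[OF bij2]
    by (subst measurable_cong[where g = "\<lambda>x i. z i \<otimes>\<^bsub>G i\<^esub> inv\<^bsub>G i\<^esub> x i", OF eq2])
       (auto intro!: measurable_coordwise)
  show "distr Q Q (\<lambda>x. z \<otimes>\<^bsub>U\<^esub> inv\<^bsub>U\<^esub> x) = Q"
    by (subst distr_cong[where g = "\<lambda>x i. z i \<otimes>\<^bsub>G i\<^esub> inv\<^bsub>G i\<^esub> x i", OF refl refl eq2])
       (auto intro!: distr_coordwise[OF bij2])
qed

lemma
  fixes f :: "(nat \<Rightarrow> 'a) \<Rightarrow> 'b :: {banach, second_countable_topology}"
  assumes z: "z \<in> carrier U" and f[measurable]: "f \<in> borel_measurable Q"
  shows integral_lmult: "(\<integral>x. f (z \<otimes>\<^bsub>U\<^esub> x) \<partial>Q) = (\<integral>x. f x \<partial>Q)"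
    and integrable_lmult: "integrable Q (\<lambda>x. f (z \<otimes>\<^bsub>U\<^esub> x)) \<longleftrightarrow> integrable Q f"
    and integral_ldiv: "(\<integral>x. f (z \<otimes>\<^bsub>U\<^esub> inv\<^bsub>U\<^esub> x) \<partial>Q) = (\<integral>x. f x \<partial>Q)"
  using integral_distr[OF measurable_lmult[OF z] f] integrable_distr_eq[OF measurable_lmult[OF z] f]
    integral_distr[OF measurable_ldiv[OF z] f]
  by (simp_all only: distr_lmult[OF z] distr_ldiv[OF z])

section \<open>Fibers over the first n coordinates and their masses\<close>

definition proj :: "(nat \<Rightarrow> 'a) \<Rightarrow> nat \<Rightarrow> 'a" where
  "proj x = restrict x {..<n}"

definition fiber :: "(nat \<Rightarrow> 'a) \<Rightarrow> (nat \<Rightarrow> 'a) set" where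
  "fiber u = {x \<in> space Q. proj x = u}"

lemma proj_closed [simp]: "x \<in> carrier U \<Longrightarrow> proj x \<in> carrier P"
  by (auto simp: proj_def)

lemma proj_mult: "proj (x \<otimes>\<^bsub>U\<^esub> y) = proj x \<otimes>\<^bsub>P\<^esub> proj y"
  by (auto simp: proj_def)

lemma proj_inv: "x \<in> carrier U \<Longrightarrow> proj (inv\<^bsub>U\<^esub> x) = inv\<^bsub>P\<^esub> proj x"
  using proj_closed[of x] by (auto simp: proj_def grp fun_eq_iff)

lemma fiber_eq:
  assumes u: "u \<in> carrier P"
  shows "fiber u = prod_emb UNIV ucm {..<n} (\<Pi>\<^sub>E i\<in>{..<n}. {u i})"
proof -
  have "restrict x {..<n} = u \<longleftrightarrow> restrict x {..<n} \<in> (\<Pi>\<^sub>E i\<in>{..<n}. {u i})" for x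
    using u by (auto simp: PiE_iff fun_eq_iff extensional_def)
  then show ?thesis
    by (auto simp: fiber_def prod_emb_def proj_def haar_def space_PiM)
qed

lemma
  assumes u: "u \<in> carrier P"
  shows sets_fiber: "fiber u \<in> sets Q"
    and measure_fiber: "measure Q (fiber u) = 1 / card (carrier P)"
proof -
  have ui: "{u i} \<in> sets (ucm i)" if "i < n" for i
    using u that by (auto simp: sets_uniform_count_measure)
  show "fiber u \<in> sets Q"
    unfolding fiber_eq[OF u] using ui by (auto simp: haar_def intro!: sets_PiM_I)
  have "measure Q (fiber u) = (\<Prod>i<n. measure (ucm i) {u i})"
    unfolding fiber_eq[OF u] haar_def using ui by (intro Q.measure_PiM_emb) auto
  also have "\<dots> = (\<Prod>i<n. 1 / card (carrier (G i)))"
    using u by (intro prod.cong refl) (auto simp: measure_uniform_count_measure[OF fin_G] PiE_iff)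
  finally show "measure Q (fiber u) = 1 / card (carrier P)"
    by (simp add: card_P prod_dividef del: carrier_product_group)
qed

lemma measurable_proj: "proj \<in> Q \<rightarrow>\<^sub>M count_space (carrier P)"
proof -
  have "proj -` {u} \<inter> space Q = fiber u" for u by (auto simp: fiber_def)
  then show ?thesis
    using sets_fiber by (auto simp: measurable_count_space_eq2 P.fin space_Q simp del: carrier_product_group)
qed

lemma measurable_cylinder [measurable]: "(\<lambda>x. f (proj x)) \<in> Q \<rightarrow>\<^sub>M borel"
  by (rule measurable_compose[OF measurable_proj]) simp

lemma integrable_mult_cylinder:
  fixes a :: "(nat \<Rightarrow> 'a) \<Rightarrow> complex"
  assumes a: "integrable Q a"
  shows "integrable Q (\<lambda>x. a x * f (proj x))"
proof -
  define C where "C = (\<Sum>u\<in>carrier P. cmod (f u))"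
  have bd: "cmod (f u) \<le> C" if "u \<in> carrier P" for u
    unfolding C_def using that by (intro member_le_sum) (auto simp: P.fin simp del: carrier_product_group)
  have le: "cmod (a x * f (proj x)) \<le> cmod (a x * of_real C)" if "x \<in> space Q" for x
  proof -
    have "x \<in> carrier U" using that by (simp only: space_Q)
    from bd[OF proj_closed[OF this]] have "cmod (f (proj x)) \<le> \<bar>C\<bar>" by linarith
    then show ?thesis unfolding norm_mult norm_of_real by (intro mult_left_mono) auto
  qed
  have am[measurable]: "a \<in> borel_measurable Q" using a by (rule borel_measurable_integrable)
  show ?thesis
  proof (rule Bochner_Integration.integrable_bound)
    show "integrable Q (\<lambda>x. a x * of_real C)" using a by (rule integrable_mult_left)
    show "AE x in Q. cmod (a x * f (proj x)) \<le> cmod (a x * of_real C)" using le by (rule AE_I2)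
  qed measurable
qed

text \<open>The mass of a on the fiber over u, not its mean value there. With this normalisation
  convolution on G becomes the plain sum convolution on P, and the map from L1 to l1 is a
  contraction.\<close>

definition coef :: "((nat \<Rightarrow> 'a) \<Rightarrow> complex) \<Rightarrow> (nat \<Rightarrow> 'a) \<Rightarrow> complex" where
  "coef a u = (\<integral>x. a x * indicator {u} (proj x) \<partial>Q)"

lemma integral_mult_cylinder:
  assumes a: "integrable Q a"
  shows "(\<integral>x. a x * f (proj x) \<partial>Q) = (\<Sum>u\<in>carrier P. coef a u * f u)"
proof -
  have "(\<integral>x. a x * f (proj x) \<partial>Q) = (\<integral>x. (\<Sum>u\<in>carrier P. a x * indicator {u} (proj x) * f u) \<partial>Q)"
  proof (rule Bochner_Integration.integral_cong[OF refl])
    fix x assume "x \<in> space Q"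
    then have px: "proj x \<in> carrier P" by (simp add: space_Q del: carrier_product_group)
    have "(\<Sum>u\<in>carrier P. a x * indicator {u} (proj x) * f u) =
          (\<Sum>u\<in>carrier P. if u = proj x then a x * f u else 0)"
      by (intro sum.cong) (auto simp: indicator_def)
    then show "a x * f (proj x) = (\<Sum>u\<in>carrier P. a x * indicator {u} (proj x) * f u)"
      using px P.fin by simp
  qed
  also have "\<dots> = (\<Sum>u\<in>carrier P. \<integral>x. a x * indicator {u} (proj x) * f u \<partial>Q)"
    using a by (intro Bochner_Integration.integral_sum integrable_mult_left integrable_mult_cylinder)
  finally show ?thesis by (simp add: coef_def)
qed

lemma coef_cong:
  assumes "\<And>x. x \<in> carrier U \<Longrightarrow> a x = b x"
  shows "coef a u = coef b u"
  unfolding coef_def by (rule Bochner_Integration.integral_cong) (use assms in \<open>auto simp: space_Q\<close>)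

lemma coef_cylinder:
  assumes u: "u \<in> carrier P"
  shows "coef (\<lambda>x. f (proj x)) u = f u / card (carrier P)"
proof -
  have "coef (\<lambda>x. f (proj x)) u = (\<integral>x. indicator (fiber u) x *\<^sub>R f u \<partial>Q)"
    unfolding coef_def by (rule Bochner_Integration.integral_cong) (auto simp: fiber_def indicator_def)
  also have "\<dots> = measure Q (fiber u) *\<^sub>R f u"
    using sets_fiber[OF u] by (simp add: PQ.emeasure_eq_measure)
  finally show ?thesis by (simp add: measure_fiber[OF u] scaleR_conv_of_real del: carrier_product_group)
qed

text \<open>The fibers partition the space, so the triangle inequality on each fiber adds up to the
  full L1 norm.\<close>

lemma sum_coef_le:
  assumes a: "integrable Q a"
  shows "(\<Sum>u\<in>carrier P. cmod (coef a u)) \<le> L1norm G a"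
proof -
  have int: "integrable Q (\<lambda>x. a x * indicator {u} (proj x))" for u
    using a by (rule integrable_mult_cylinder)
  have "(\<Sum>u\<in>carrier P. cmod (coef a u)) \<le> (\<Sum>u\<in>carrier P. \<integral>x. cmod (a x * indicator {u} (proj x)) \<partial>Q)"
    unfolding coef_def by (intro sum_mono integral_norm_bound)
  also have "\<dots> = (\<integral>x. (\<Sum>u\<in>carrier P. cmod (a x * indicator {u} (proj x))) \<partial>Q)"
    by (intro Bochner_Integration.integral_sum[symmetric] integrable_norm int)
  also have "\<dots> = (\<integral>x. cmod (a x) \<partial>Q)"
  proof (rule Bochner_Integration.integral_cong[OF refl])
    fix x assume "x \<in> space Q"
    then have px: "proj x \<in> carrier P" by (simp add: space_Q del: carrier_product_group)
    have "(\<Sum>u\<in>carrier P. cmod (a x * indicator {u} (proj x))) =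
          (\<Sum>u\<in>carrier P. if u = proj x then cmod (a x) else 0)"
      by (intro sum.cong) (auto simp: indicator_def)
    then show "(\<Sum>u\<in>carrier P. cmod (a x * indicator {u} (proj x))) = cmod (a x)"
      using px P.fin by simp
  qed
  finally show ?thesis by (simp add: L1norm_def)
qed

lemma cmod_coef_le:
  assumes a: "integrable Q a" and u: "u \<in> carrier P"
  shows "cmod (coef a u) \<le> L1norm G a"
  using sum_coef_le[OF a] member_le_sum[OF u, of "\<lambda>u. cmod (coef a u)"] P.fin by force

text \<open>Every fiber has positive measure, so a property of the first n coordinates cannot fail
  only on a null set. This turns the almost everywhere identities defining the centre into
  identities on P.\<close>

lemma AE_cylinder:
  assumes AE: "AE x in Q. R (proj x)" and u: "u \<in> carrier P"
  shows "R u"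
proof (rule ccontr)
  assume "\<not> R u"
  with AE have "AE x in Q. x \<notin> fiber u" by (auto simp: fiber_def)
  then have "measure Q (fiber u) = 0"
    using sets_fiber[OF u] by (simp add: AE_iff_measurable[OF _ refl] PQ.prob_eq_0)
  then show False using measure_fiber[OF u] P.card_pos by simp
qed

section \<open>Convolution and its projection\<close>

lemma conv_cong:
  assumes "\<And>y. y \<in> carrier U \<Longrightarrow> a y = a' y" "\<And>y. y \<in> carrier U \<Longrightarrow> b y = b' y"
    and x: "x \<in> carrier U"
  shows "conv G a b x = conv G a' b' x"
  unfolding conv_def
proof (rule Bochner_Integration.integral_cong[OF refl])
  fix y assume "y \<in> space Q"
  then have "y \<in> carrier U" by (simp only: space_Q)
  with x have "inv\<^bsub>U\<^esub> y \<otimes>\<^bsub>U\<^esub> x \<in> carrier U" "y \<in> carrier U"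
    by (blast intro: U.m_closed U.inv_closed)+
  then show "a y * b (inv\<^bsub>U\<^esub> y \<otimes>\<^bsub>U\<^esub> x) = a' y * b' (inv\<^bsub>U\<^esub> y \<otimes>\<^bsub>U\<^esub> x)"
    by (simp only: assms)
qed

lemma conv_cylinder_right:
  assumes a: "integrable Q a" and x: "x \<in> carrier U"
  shows "conv G a (\<lambda>y. f (proj y)) x = (\<Sum>u\<in>carrier P. coef a u * f (inv\<^bsub>P\<^esub> u \<otimes>\<^bsub>P\<^esub> proj x))"
proof -
  have "conv G a (\<lambda>y. f (proj y)) x = (\<integral>y. a y * f (inv\<^bsub>P\<^esub> proj y \<otimes>\<^bsub>P\<^esub> proj x) \<partial>Q)"
    unfolding conv_def
    by (rule Bochner_Integration.integral_cong[OF refl]) (simp only: space_Q proj_mult proj_inv)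
  also have "\<dots> = (\<Sum>u\<in>carrier P. coef a u * f (inv\<^bsub>P\<^esub> u \<otimes>\<^bsub>P\<^esub> proj x))"
    by (rule integral_mult_cylinder[OF a])
  finally show ?thesis .
qed

lemma conv_cylinder_left:
  assumes a: "integrable Q a" and x: "x \<in> carrier U"
  shows "conv G (\<lambda>y. f (proj y)) a x = (\<Sum>u\<in>carrier P. coef a u * f (proj x \<otimes>\<^bsub>P\<^esub> inv\<^bsub>P\<^esub> u))"
proof -
  have am: "a \<in> borel_measurable Q" using a by auto
  have "(\<lambda>y. (y, x)) \<in> Q \<rightarrow>\<^sub>M Q \<Otimes>\<^sub>M Q" using x by (simp add: measurable_Pair2' measurable_Pair1' space_Q del: carrier_product_group)
  from measurable_compose[OF this measurable_div]
  have "(\<lambda>y. inv\<^bsub>U\<^esub> y \<otimes>\<^bsub>U\<^esub> x) \<in> Q \<rightarrow>\<^sub>M Q" by (simp only: fst_conv snd_conv)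
  then have Fm: "(\<lambda>y. f (proj y) * a (inv\<^bsub>U\<^esub> y \<otimes>\<^bsub>U\<^esub> x)) \<in> borel_measurable Q"
    by (intro borel_measurable_times measurable_cylinder measurable_compose[OF _ am])
  \<comment> \<open>The substitution y = x z^-1 moves the argument z onto a, after which the
    cylinder factor is integrated against a.\<close>
  have "conv G (\<lambda>y. f (proj y)) a x =
     (\<integral>z. f (proj (x \<otimes>\<^bsub>U\<^esub> inv\<^bsub>U\<^esub> z)) * a (inv\<^bsub>U\<^esub> (x \<otimes>\<^bsub>U\<^esub> inv\<^bsub>U\<^esub> z) \<otimes>\<^bsub>U\<^esub> x) \<partial>Q)"
    unfolding conv_def by (rule integral_ldiv[OF x Fm, symmetric])
  also have "\<dots> = (\<integral>z. a z * f (proj x \<otimes>\<^bsub>P\<^esub> inv\<^bsub>P\<^esub> proj z) \<partial>Q)"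
  proof (rule Bochner_Integration.integral_cong[OF refl])
    fix z assume "z \<in> space Q"
    then have z: "z \<in> carrier U" by (simp only: space_Q)
    have "inv\<^bsub>U\<^esub> (x \<otimes>\<^bsub>U\<^esub> inv\<^bsub>U\<^esub> z) \<otimes>\<^bsub>U\<^esub> x = z"
      using x z by (simp add: U.inv_mult_group U.m_assoc del: carrier_product_group mult_product_group inv_product_group one_product_group)
    then show "f (proj (x \<otimes>\<^bsub>U\<^esub> inv\<^bsub>U\<^esub> z)) * a (inv\<^bsub>U\<^esub> (x \<otimes>\<^bsub>U\<^esub> inv\<^bsub>U\<^esub> z) \<otimes>\<^bsub>U\<^esub> x) =
       a z * f (proj x \<otimes>\<^bsub>P\<^esub> inv\<^bsub>P\<^esub> proj z)"
      by (simp only: proj_mult proj_inv[OF z] mult.commute)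
  qed
  also have "\<dots> = (\<Sum>u\<in>carrier P. coef a u * f (proj x \<otimes>\<^bsub>P\<^esub> inv\<^bsub>P\<^esub> u))"
    by (rule integral_mult_cylinder[OF a])
  finally show ?thesis .
qed

text \<open>Left invariance makes the inner integral of |b(y^-1 x)| equal to the norm of b for every
  y, which is what the Fubini criterion asks for.\<close>

lemma
  assumes a: "integrable Q a" and b: "integrable Q b"
  shows integrable_conv_kernel:
      "integrable (Q \<Otimes>\<^sub>M Q) (\<lambda>(y, x). a y * b (inv\<^bsub>U\<^esub> y \<otimes>\<^bsub>U\<^esub> x))" (is "integrable _ ?k")
    and integral_norm_conv_kernel:
      "(\<integral>y. (\<integral>x. cmod (a y * b (inv\<^bsub>U\<^esub> y \<otimes>\<^bsub>U\<^esub> x)) \<partial>Q) \<partial>Q) = L1norm G a * L1norm G b"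
proof -
  have am: "a \<in> borel_measurable Q" and bm: "b \<in> borel_measurable Q"
    using a b by auto
  have "(\<lambda>q. a (fst q) * b (inv\<^bsub>U\<^esub> (fst q) \<otimes>\<^bsub>U\<^esub> snd q)) \<in> borel_measurable (Q \<Otimes>\<^sub>M Q)"
    by (intro borel_measurable_times measurable_compose[OF measurable_fst am]
        measurable_compose[OF measurable_div bm])
  then have km: "?k \<in> borel_measurable (Q \<Otimes>\<^sub>M Q)" by (simp only: case_prod_beta')
  have inner: "(\<integral>x. cmod (a y * b (inv\<^bsub>U\<^esub> y \<otimes>\<^bsub>U\<^esub> x)) \<partial>Q) = cmod (a y) * L1norm G b"
    if "y \<in> space Q" for y
  proof -
    have iy: "inv\<^bsub>U\<^esub> y \<in> carrier U" using that unfolding space_Q by (rule U.inv_closed)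
    have "(\<integral>x. cmod (a y * b (inv\<^bsub>U\<^esub> y \<otimes>\<^bsub>U\<^esub> x)) \<partial>Q) =
        cmod (a y) * (\<integral>x. cmod (b (inv\<^bsub>U\<^esub> y \<otimes>\<^bsub>U\<^esub> x)) \<partial>Q)"
      unfolding norm_mult by (rule integral_mult_right_zero)
    also have "(\<integral>x. cmod (b (inv\<^bsub>U\<^esub> y \<otimes>\<^bsub>U\<^esub> x)) \<partial>Q) = L1norm G b"
      unfolding L1norm_def using bm by (intro integral_lmult[OF iy, of "\<lambda>x. cmod (b x)"]) measurable
    finally show ?thesis .
  qed
  show "integrable (Q \<Otimes>\<^sub>M Q) ?k"
  proof (rule QQ.Fubini_integrable[OF km])
    have "integrable Q (\<lambda>y. cmod (a y) * L1norm G b)" using a by (intro integrable_mult_left integrable_norm)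
    also have "?this \<longleftrightarrow> integrable Q (\<lambda>y. \<integral>x. cmod (?k (y, x)) \<partial>Q)"
      by (rule Bochner_Integration.integrable_cong[OF refl]) (simp only: inner prod.case)
    finally show "integrable Q (\<lambda>y. \<integral>x. cmod (?k (y, x)) \<partial>Q)" .
    show "AE y in Q. integrable Q (\<lambda>x. ?k (y, x))"
    proof (rule AE_I2)
      fix y assume "y \<in> space Q"
      then have iy: "inv\<^bsub>U\<^esub> y \<in> carrier U" unfolding space_Q by (rule U.inv_closed)
      have "integrable Q (\<lambda>x. a y * b (inv\<^bsub>U\<^esub> y \<otimes>\<^bsub>U\<^esub> x))"
        using integrable_lmult[OF iy bm] b by (intro integrable_mult_right) blast
      then show "integrable Q (\<lambda>x. ?k (y, x))" by (simp only: prod.case)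
    qed
  qed
  have "(\<integral>y. (\<integral>x. cmod (a y * b (inv\<^bsub>U\<^esub> y \<otimes>\<^bsub>U\<^esub> x)) \<partial>Q) \<partial>Q) = (\<integral>y. cmod (a y) * L1norm G b \<partial>Q)"
    by (rule Bochner_Integration.integral_cong[OF refl inner])
  then show "(\<integral>y. (\<integral>x. cmod (a y * b (inv\<^bsub>U\<^esub> y \<otimes>\<^bsub>U\<^esub> x)) \<partial>Q) \<partial>Q) = L1norm G a * L1norm G b"
    by (simp only: L1norm_def integral_mult_left_zero)
qed

lemma
  assumes a: "integrable Q a" and b: "integrable Q b"
  shows integrable_conv: "integrable Q (conv G a b)"
    and L1norm_conv_le: "L1norm G (conv G a b) \<le> L1norm G a * L1norm G b"
proof -
  let ?k = "\<lambda>y x. a y * b (inv\<^bsub>U\<^esub> y \<otimes>\<^bsub>U\<^esub> x)"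
  note k = integrable_conv_kernel[OF a b]
  have nk: "integrable (Q \<Otimes>\<^sub>M Q) (\<lambda>(y, x). cmod (?k y x))"
    using integrable_norm[OF k] by (simp only: case_prod_beta')
  show ic: "integrable Q (conv G a b)"
    unfolding conv_def by (rule QQ.integrable_snd[OF k])
  have "L1norm G (conv G a b) \<le> (\<integral>x. (\<integral>y. cmod (?k y x) \<partial>Q) \<partial>Q)"
    unfolding L1norm_def
  proof (rule integral_mono)
    show "integrable Q (\<lambda>x. cmod (conv G a b x))" using ic by (rule integrable_norm)
    show "integrable Q (\<lambda>x. \<integral>y. cmod (?k y x) \<partial>Q)" by (rule QQ.integrable_snd[OF nk])
  qed (simp only: conv_def integral_norm_bound)
  also have "\<dots> = (\<integral>y. (\<integral>x. cmod (?k y x) \<partial>Q) \<partial>Q)"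
    by (rule QQ.Fubini_integral[OF nk])
  also have "\<dots> = L1norm G a * L1norm G b"
    by (rule integral_norm_conv_kernel[OF a b])
  finally show "L1norm G (conv G a b) \<le> L1norm G a * L1norm G b" .
qed

text \<open>Projection is a homomorphism with finite image: after Fubini, the condition that x lies
  over u becomes a condition on y^-1 x, and translation leaves a fiber mass of b that depends only
  on the projection of y.\<close>

lemma coef_conv:
  assumes a: "integrable Q a" and b: "integrable Q b" and u: "u \<in> carrier P"
  shows "coef (conv G a b) u = (\<Sum>v\<in>carrier P. coef a v * coef b (inv\<^bsub>P\<^esub> v \<otimes>\<^bsub>P\<^esub> u))"
proof -
  let ?k = "\<lambda>y x. a y * b (inv\<^bsub>U\<^esub> y \<otimes>\<^bsub>U\<^esub> x)"
  let ?i = "\<lambda>x. indicator {u} (proj x) :: complex"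
  have am: "a \<in> borel_measurable Q" and bm: "b \<in> borel_measurable Q"
    using a b by auto
  note k = integrable_conv_kernel[OF a b]
  have S: "space Q \<times> fiber u \<in> sets (Q \<Otimes>\<^sub>M Q)" using sets_fiber[OF u] by auto
  have "integrable (Q \<Otimes>\<^sub>M Q) (\<lambda>q. indicator (space Q \<times> fiber u) q *\<^sub>R (case q of (y, x) \<Rightarrow> ?k y x))"
    by (rule integrable_mult_indicator[OF S k])
  also have "?this \<longleftrightarrow> integrable (Q \<Otimes>\<^sub>M Q) (\<lambda>(y, x). ?k y x * ?i x)"
    by (rule Bochner_Integration.integrable_cong[OF refl])
       (auto simp: fiber_def indicator_def space_pair_measure simp del: carrier_product_group)
  finally have ki: "integrable (Q \<Otimes>\<^sub>M Q) (\<lambda>(y, x). ?k y x * ?i x)" .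
  have "coef (conv G a b) u = (\<integral>x. (\<integral>y. ?k y x * ?i x \<partial>Q) \<partial>Q)"
    unfolding coef_def conv_def by (simp only: integral_mult_left_zero)
  also have "\<dots> = (\<integral>y. (\<integral>x. ?k y x * ?i x \<partial>Q) \<partial>Q)"
    by (rule QQ.Fubini_integral[OF ki])
  also have "\<dots> = (\<integral>y. a y * coef b (inv\<^bsub>P\<^esub> proj y \<otimes>\<^bsub>P\<^esub> u) \<partial>Q)"
  proof (rule Bochner_Integration.integral_cong[OF refl])
    fix y assume "y \<in> space Q"
    then have y: "y \<in> carrier U" by (simp only: space_Q)
    have pxP: "proj y \<in> carrier P" using y by (rule proj_closed)
    define z where "z = inv\<^bsub>U\<^esub> y"
    have z: "z \<in> carrier U" using y unfolding z_def by (rule U.inv_closed)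
    have pz: "proj z = inv\<^bsub>P\<^esub> proj y" unfolding z_def by (rule proj_inv[OF y])
    have ind: "?i x = indicator {inv\<^bsub>P\<^esub> proj y \<otimes>\<^bsub>P\<^esub> u} (proj (z \<otimes>\<^bsub>U\<^esub> x))" if x: "x \<in> space Q" for x
    proof -
      have px: "proj x \<in> carrier P" using x unfolding space_Q by (rule proj_closed)
      have "proj x = u \<longleftrightarrow> inv\<^bsub>P\<^esub> proj y \<otimes>\<^bsub>P\<^esub> proj x = inv\<^bsub>P\<^esub> proj y \<otimes>\<^bsub>P\<^esub> u"
        using px u pxP by (metis P.inv_mult_cancel(2))
      then show ?thesis by (simp only: indicator_def proj_mult pz singleton_iff)
    qed
    have "(\<integral>x. ?k y x * ?i x \<partial>Q) =
       (\<integral>x. a y * (b (z \<otimes>\<^bsub>U\<^esub> x) * indicator {inv\<^bsub>P\<^esub> proj y \<otimes>\<^bsub>P\<^esub> u} (proj (z \<otimes>\<^bsub>U\<^esub> x))) \<partial>Q)"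
      by (rule Bochner_Integration.integral_cong[OF refl]) (simp only: ind z_def mult.assoc)
    also have "\<dots> = a y * (\<integral>x. b (z \<otimes>\<^bsub>U\<^esub> x) * indicator {inv\<^bsub>P\<^esub> proj y \<otimes>\<^bsub>P\<^esub> u} (proj (z \<otimes>\<^bsub>U\<^esub> x)) \<partial>Q)"
      by (rule integral_mult_right_zero)
    also have "(\<integral>x. b (z \<otimes>\<^bsub>U\<^esub> x) * indicator {inv\<^bsub>P\<^esub> proj y \<otimes>\<^bsub>P\<^esub> u} (proj (z \<otimes>\<^bsub>U\<^esub> x)) \<partial>Q) =
        coef b (inv\<^bsub>P\<^esub> proj y \<otimes>\<^bsub>P\<^esub> u)"
      unfolding coef_def using bm
      by (intro integral_lmult[OF z, of "\<lambda>x. b x * indicator {inv\<^bsub>P\<^esub> proj y \<otimes>\<^bsub>P\<^esub> u} (proj x)"]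
          borel_measurable_times measurable_cylinder)
    finally show "(\<integral>x. ?k y x * ?i x \<partial>Q) = a y * coef b (inv\<^bsub>P\<^esub> proj y \<otimes>\<^bsub>P\<^esub> u)" .
  qed
  also have "\<dots> = (\<Sum>v\<in>carrier P. coef a v * coef b (inv\<^bsub>P\<^esub> v \<otimes>\<^bsub>P\<^esub> u))"
    by (rule integral_mult_cylinder[OF a])
  finally show ?thesis .
qed

section \<open>The centre seen through fiber masses\<close>

lemma ZL1_integrable: "a \<in> ZL1 G \<Longrightarrow> integrable Q a"
  by (simp add: ZL1_def)

lemma integrable_cylinder:
  fixes f :: "(nat \<Rightarrow> 'a) \<Rightarrow> complex"
  shows "integrable Q (\<lambda>x. f (proj x))"
  using integrable_mult_cylinder[of "\<lambda>_. 1" f] by simp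

lemma sum_indicator_rdiv:
  assumes g: "g \<in> carrier P" and p: "p \<in> carrier P"
  shows "(\<Sum>u\<in>carrier P. F u * indicator {g} (inv\<^bsub>P\<^esub> u \<otimes>\<^bsub>P\<^esub> p)) = (F (p \<otimes>\<^bsub>P\<^esub> inv\<^bsub>P\<^esub> g) :: complex)"
    and "(\<Sum>u\<in>carrier P. F u * indicator {g} (p \<otimes>\<^bsub>P\<^esub> inv\<^bsub>P\<^esub> u)) = (F (inv\<^bsub>P\<^esub> g \<otimes>\<^bsub>P\<^esub> p) :: complex)"
proof -
  note [simp del] = carrier_product_group mult_product_group inv_product_group one_product_group
  have 1: "inv\<^bsub>P\<^esub> u \<otimes>\<^bsub>P\<^esub> p = g \<longleftrightarrow> u = p \<otimes>\<^bsub>P\<^esub> inv\<^bsub>P\<^esub> g" if u: "u \<in> carrier P" for u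
  proof
    assume "inv\<^bsub>P\<^esub> u \<otimes>\<^bsub>P\<^esub> p = g"
    then have "p = u \<otimes>\<^bsub>P\<^esub> g" using u p by (metis P.inv_mult_cancel(2))
    then show "u = p \<otimes>\<^bsub>P\<^esub> inv\<^bsub>P\<^esub> g" using u g by (simp add: P.m_assoc)
  next
    assume "u = p \<otimes>\<^bsub>P\<^esub> inv\<^bsub>P\<^esub> g"
    then show "inv\<^bsub>P\<^esub> u \<otimes>\<^bsub>P\<^esub> p = g" using p g by (simp add: P.inv_mult_group P.m_assoc)
  qed
  have 2: "p \<otimes>\<^bsub>P\<^esub> inv\<^bsub>P\<^esub> u = g \<longleftrightarrow> u = inv\<^bsub>P\<^esub> g \<otimes>\<^bsub>P\<^esub> p" if u: "u \<in> carrier P" for u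
  proof
    assume "p \<otimes>\<^bsub>P\<^esub> inv\<^bsub>P\<^esub> u = g"
    then have "p = g \<otimes>\<^bsub>P\<^esub> u" using u p by (metis P.inv_closed P.l_inv P.m_assoc P.r_one)
    then show "u = inv\<^bsub>P\<^esub> g \<otimes>\<^bsub>P\<^esub> p" using u g by simp
  next
    assume "u = inv\<^bsub>P\<^esub> g \<otimes>\<^bsub>P\<^esub> p"
    then show "p \<otimes>\<^bsub>P\<^esub> inv\<^bsub>P\<^esub> u = g" using p g by (simp add: P.inv_mult_group)
  qed
  have "(\<Sum>u\<in>carrier P. F u * indicator {g} (inv\<^bsub>P\<^esub> u \<otimes>\<^bsub>P\<^esub> p)) =
     (\<Sum>u\<in>carrier P. if u = p \<otimes>\<^bsub>P\<^esub> inv\<^bsub>P\<^esub> g then F u else 0)"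
    by (intro sum.cong refl) (simp add: indicator_def 1)
  then show "(\<Sum>u\<in>carrier P. F u * indicator {g} (inv\<^bsub>P\<^esub> u \<otimes>\<^bsub>P\<^esub> p)) = F (p \<otimes>\<^bsub>P\<^esub> inv\<^bsub>P\<^esub> g)"
    using g p P.fin by simp
  have "(\<Sum>u\<in>carrier P. F u * indicator {g} (p \<otimes>\<^bsub>P\<^esub> inv\<^bsub>P\<^esub> u)) =
     (\<Sum>u\<in>carrier P. if u = inv\<^bsub>P\<^esub> g \<otimes>\<^bsub>P\<^esub> p then F u else 0)"
    by (intro sum.cong refl) (simp add: indicator_def 2)
  then show "(\<Sum>u\<in>carrier P. F u * indicator {g} (p \<otimes>\<^bsub>P\<^esub> inv\<^bsub>P\<^esub> u)) = F (inv\<^bsub>P\<^esub> g \<otimes>\<^bsub>P\<^esub> p)"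
    using g p P.fin by simp
qed

text \<open>Commuting with the indicator of the fiber over h says that the mass at p h^-1 equals the
  mass at h^-1 p. The claim is the case p = h y.\<close>

lemma coef_class_function:
  assumes a: "a \<in> ZL1 G" and h: "h \<in> carrier P" and y: "y \<in> carrier P"
  shows "coef a (h \<otimes>\<^bsub>P\<^esub> y \<otimes>\<^bsub>P\<^esub> inv\<^bsub>P\<^esub> h) = coef a y"
proof -
  have ia: "integrable Q a" by (rule ZL1_integrable[OF a])
  have "integrable Q (\<lambda>x. indicator {h} (proj x) :: complex)" by (rule integrable_cylinder)
  then have "AE x in Q. conv G a (\<lambda>x. indicator {h} (proj x)) x = conv G (\<lambda>x. indicator {h} (proj x)) a x"
    using a by (simp add: ZL1_def)
  then have "AE x in Q. coef a (proj x \<otimes>\<^bsub>P\<^esub> inv\<^bsub>P\<^esub> h) = coef a (inv\<^bsub>P\<^esub> h \<otimes>\<^bsub>P\<^esub> proj x)"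
  proof (rule AE_mp, intro AE_I2 impI)
    fix x assume "x \<in> space Q"
      and eq: "conv G a (\<lambda>x. indicator {h} (proj x)) x = conv G (\<lambda>x. indicator {h} (proj x)) a x"
    then have x: "x \<in> carrier U" by (simp only: space_Q)
    show "coef a (proj x \<otimes>\<^bsub>P\<^esub> inv\<^bsub>P\<^esub> h) = coef a (inv\<^bsub>P\<^esub> h \<otimes>\<^bsub>P\<^esub> proj x)"
      using eq unfolding conv_cylinder_right[OF ia x] conv_cylinder_left[OF ia x]
        sum_indicator_rdiv[OF h proj_closed[OF x]] .
  qed
  from AE_cylinder[OF this P.m_closed[OF h y]] show ?thesis
    by (simp only: P.inv_mult_cancel(1)[OF h y])
qed

text \<open>Only agreement on the carrier is asked of a, because it is applied to convolutions,
  whose values are computed only there.\<close>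

lemma class_cylinder_in_ZL1:
  assumes f: "\<And>x y. \<lbrakk>x \<in> carrier P; y \<in> carrier P\<rbrakk> \<Longrightarrow> f (x \<otimes>\<^bsub>P\<^esub> y) = f (y \<otimes>\<^bsub>P\<^esub> x)"
    and a: "\<And>x. x \<in> carrier U \<Longrightarrow> a x = f (proj x)"
  shows "a \<in> ZL1 G"
proof -
  have "integrable Q a \<longleftrightarrow> integrable Q (\<lambda>x. f (proj x))"
    by (rule Bochner_Integration.integrable_cong[OF refl]) (simp only: a space_Q)
  then have "integrable Q a" using integrable_cylinder by blast
  moreover have "AE x in Q. conv G a g x = conv G g a x" if g: "integrable Q g" for g
  proof (rule AE_I2)
    fix x assume "x \<in> space Q"
    then have x: "x \<in> carrier U" by (simp only: space_Q)
    have "conv G a g x = conv G (\<lambda>x. f (proj x)) g x" by (rule conv_cong[OF a refl x])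
    also have "\<dots> = conv G g (\<lambda>x. f (proj x)) x"
      unfolding conv_cylinder_right[OF g x] conv_cylinder_left[OF g x]
      using proj_closed[OF x] by (intro sum.cong refl arg_cong2[of _ _ _ _ "(*)"] f P.inv_closed)
    also have "\<dots> = conv G g a x" by (rule conv_cong[OF refl a[symmetric] x])
    finally show "conv G a g x = conv G g a x" .
  qed
  ultimately show ?thesis by (simp only: ZL1_def mem_Collect_eq) blast
qed

end

section \<open>Tensors and approximate diagonals\<close>

text \<open>The alternating layout is that of \<open>tensor_diff\<close>. Each half is a series
  padded with zeros, to be reindexed along the even or the odd numbers.\<close>

lemma sums_interleave:
  fixes f g :: "nat \<Rightarrow> 'a :: real_normed_vector"
  assumes "f sums x" "g sums y"
  shows "(\<lambda>n. if even n then f (n div 2) else g (n div 2)) sums (x + y)"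
proof -
  have "(\<lambda>n. if even n then f (n div 2) else 0) sums x"
  proof (subst sums_mono_reindex[symmetric, of "\<lambda>n. 2 * n"])
    show "(if even k then f (k div 2) else 0) = 0" if "k \<notin> range (\<lambda>n. 2 * n)" for k
      using that by (auto elim!: evenE)
  qed (use assms in \<open>auto simp: strict_mono_def\<close>)
  moreover have "(\<lambda>n. if even n then 0 else g (n div 2)) sums y"
  proof (subst sums_mono_reindex[symmetric, of "\<lambda>n. 2 * n + 1"])
    show "(if even k then 0 else g (k div 2)) = 0" if "k \<notin> range (\<lambda>n. 2 * n + 1)" for k
      using that by (auto elim!: oddE)
  qed (use assms in \<open>auto simp: strict_mono_def\<close>)
  ultimately have "(\<lambda>n. (if even n then f (n div 2) else 0) + (if even n then 0 else g (n div 2))) sums (x + y)"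
    by (rule sums_add)
  then show ?thesis by (rule sums_cong[THEN iffD1, rotated]) auto
qed

context fin_group_seq
begin

section \<open>Bilinear test forms and coefficient matrices\<close>

lemma L1norm_nonneg: "L1norm G a \<ge> 0"
  by (simp add: L1norm_def)

lemma coef_add:
  assumes "integrable Q a" "integrable Q b"
  shows "coef (\<lambda>x. a x + b x) u = coef a u + coef b u"
  unfolding coef_def distrib_right using assms
  by (intro Bochner_Integration.integral_add integrable_mult_cylinder)

lemma coef_scale: "coef (\<lambda>x. s * a x) u = s * coef a u"
  unfolding coef_def mult.assoc by (rule integral_mult_right_zero)

lemma coef_uminus: "coef (\<lambda>x. - a x) u = - coef a u"
  using coef_scale[of "-1" a u] by simp

text \<open>Projected tensors live in l1(P x P), whose dual is the space of bounded matrices. These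
  forms are that dual, pulled back to the centre and restricted to real matrices.\<close>

definition coef_form ::
  "((nat \<Rightarrow> 'a) \<Rightarrow> (nat \<Rightarrow> 'a) \<Rightarrow> real) \<Rightarrow> ((nat \<Rightarrow> 'a) \<Rightarrow> complex) \<Rightarrow> ((nat \<Rightarrow> 'a) \<Rightarrow> complex) \<Rightarrow> complex" where
  "coef_form w a b = (\<Sum>x\<in>carrier P. \<Sum>y\<in>carrier P. of_real (w x y) * (coef a x * coef b y))"

lemma coef_form_le:
  assumes w: "\<And>x y. \<bar>w x y\<bar> \<le> 1" and a: "integrable Q a" and b: "integrable Q b"
  shows "cmod (coef_form w a b) \<le> L1norm G a * L1norm G b"
proof -
  have "cmod (coef_form w a b) \<le> (\<Sum>x\<in>carrier P. \<Sum>y\<in>carrier P. cmod (of_real (w x y) * (coef a x * coef b y)))"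
    unfolding coef_form_def by (intro sum_norm_le norm_sum)
  also have "\<dots> \<le> (\<Sum>x\<in>carrier P. \<Sum>y\<in>carrier P. cmod (coef a x) * cmod (coef b y))"
    using w unfolding norm_mult norm_of_real by (intro sum_mono mult_left_le_one_le) auto
  also have "\<dots> = (\<Sum>x\<in>carrier P. cmod (coef a x)) * (\<Sum>y\<in>carrier P. cmod (coef b y))"
    by (simp only: sum_product)
  also have "\<dots> \<le> L1norm G a * L1norm G b"
    using a b by (intro mult_mono sum_coef_le sum_nonneg L1norm_nonneg) auto
  finally show ?thesis .
qed

lemma coef_form_bounded:
  assumes w: "\<And>x y. \<bar>w x y\<bar> \<le> 1"
  shows "bounded_bilinear_form G (coef_form w)"
  unfolding bounded_bilinear_form_def
proof (intro conjI ballI allI exI[of _ 1])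
  fix a b c assume "a \<in> ZL1 G" "b \<in> ZL1 G" "c \<in> ZL1 G"
  note i = this[THEN ZL1_integrable]
  show "coef_form w (\<lambda>x. a x + b x) c = coef_form w a c + coef_form w b c"
    using i by (simp only: coef_form_def coef_add distrib_left distrib_right sum.distrib)
  show "coef_form w a (\<lambda>x. b x + c x) = coef_form w a b + coef_form w a c"
    using i by (simp only: coef_form_def coef_add distrib_left distrib_right sum.distrib)
next
  fix s a b
  show "coef_form w (\<lambda>x. s * a x) b = s * coef_form w a b"
    "coef_form w a (\<lambda>x. s * b x) = s * coef_form w a b"
    by (simp_all only: coef_form_def coef_scale sum_distrib_left mult_ac)
next
  fix a b assume "a \<in> ZL1 G" "b \<in> ZL1 G"
  then show "cmod (coef_form w a b) \<le> 1 * L1norm G a * L1norm G b"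
    using coef_form_le[OF w] by (simp add: ZL1_integrable)
qed

text \<open>A bounded form takes the same value on all representations of a tensor, and one of norm
  at most 1 is dominated by the cost of each of them, hence by the infimum. All lower bounds for the
  projective norm come from here.\<close>

lemma coef_form_suminf_le_proj_norm:
  assumes w: "\<And>x y. \<bar>w x y\<bar> \<le> 1" and u: "tensor_rep G u"
  shows "cmod (\<Sum>k. coef_form w (fst (u k)) (snd (u k))) \<le> proj_norm G u"
  unfolding proj_norm_def
proof (rule cInf_greatest)
  show "{\<Sum>k. L1norm G (fst (v k)) * L1norm G (snd (v k)) |v. tensor_rep G v \<and> tensor_eq G u v} \<noteq> {}"
    using u by (auto simp: tensor_eq_def)
next
  fix r assume "r \<in> {\<Sum>k. L1norm G (fst (v k)) * L1norm G (snd (v k)) |v. tensor_rep G v \<and> tensor_eq G u v}"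
  then obtain v where v: "tensor_rep G v" "tensor_eq G u v"
    and r: "r = (\<Sum>k. L1norm G (fst (v k)) * L1norm G (snd (v k)))" by blast
  have "(\<Sum>k. coef_form w (fst (u k)) (snd (u k))) = (\<Sum>k. coef_form w (fst (v k)) (snd (v k)))"
    using v coef_form_bounded[OF w] by (simp add: tensor_eq_def)
  also have "cmod \<dots> \<le> r"
    unfolding r using v coef_form_le[OF w]
    by (intro norm_suminf_le) (auto simp: tensor_rep_def ZL1_integrable)
  finally show "cmod (\<Sum>k. coef_form w (fst (u k)) (snd (u k))) \<le> r" .
qed

text \<open>The matrix of masses of the projected tensor on P x P.\<close>

definition tensor_coef :: "'a tensor \<Rightarrow> (nat \<Rightarrow> 'a) \<Rightarrow> (nat \<Rightarrow> 'a) \<Rightarrow> complex" where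
  "tensor_coef u x y = (\<Sum>k. coef (fst (u k)) x * coef (snd (u k)) y)"

lemma tensor_repD:
  assumes "tensor_rep G u"
  shows "fst (u k) \<in> ZL1 G" "snd (u k) \<in> ZL1 G"
    and "integrable Q (fst (u k))" "integrable Q (snd (u k))"
    and "summable (\<lambda>k. L1norm G (fst (u k)) * L1norm G (snd (u k)))"
  using assms by (auto simp: tensor_rep_def ZL1_integrable)

lemma tensor_coef_sums:
  assumes u: "tensor_rep G u" and x: "x \<in> carrier P" and y: "y \<in> carrier P"
  shows "(\<lambda>k. coef (fst (u k)) x * coef (snd (u k)) y) sums tensor_coef u x y"
proof -
  have "summable (\<lambda>k. coef (fst (u k)) x * coef (snd (u k)) y)"
  proof (rule summable_comparison_test'[OF tensor_repD(5)[OF u]])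
    show "cmod (coef (fst (u k)) x * coef (snd (u k)) y) \<le> L1norm G (fst (u k)) * L1norm G (snd (u k))" for k
      unfolding norm_mult using x y tensor_repD[OF u]
      by (intro mult_mono cmod_coef_le L1norm_nonneg) auto
  qed
  then show ?thesis unfolding tensor_coef_def by (rule summable_sums)
qed

lemma coef_form_sums:
  assumes u: "tensor_rep G u"
  shows "(\<lambda>k. coef_form w (fst (u k)) (snd (u k))) sums
     (\<Sum>x\<in>carrier P. \<Sum>y\<in>carrier P. of_real (w x y) * tensor_coef u x y)"
  unfolding coef_form_def by (intro sums_sum sums_mult tensor_coef_sums[OF u])

lemma tensor_coef_class_function:
  assumes u: "tensor_rep G u" and h: "h \<in> carrier P" and y: "y \<in> carrier P"
  shows "tensor_coef u x (h \<otimes>\<^bsub>P\<^esub> y \<otimes>\<^bsub>P\<^esub> inv\<^bsub>P\<^esub> h) = tensor_coef u x y"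
  unfolding tensor_coef_def using tensor_repD(2)[OF u] h y
  by (simp only: coef_class_function)

lemma coef_form_single:
  assumes x: "x \<in> carrier P" and y: "y \<in> carrier P"
  shows "coef_form (\<lambda>x' y'. if x' = x \<and> y' = y then 1 else 0) a b = coef a x * coef b y"
proof -
  have "coef_form (\<lambda>x' y'. if x' = x \<and> y' = y then 1 else 0) a b =
      (\<Sum>x'\<in>carrier P. \<Sum>y'\<in>carrier P. if y' = y then (if x' = x then coef a x * coef b y else 0) else 0)"
    unfolding coef_form_def by (intro sum.cong refl) auto
  also have "\<dots> = coef a x * coef b y"
    using x y P.fin by (simp only: sum.delta if_True)
  finally show ?thesis .
qed

section \<open>Acting on tensors with class indicators\<close>

text \<open>This is the class indicator of g times the order of the centraliser. The weight is
  chosen so that the fiber masses of \<open>class_cyl g\<close> form the uniform probability on the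
  class of g, with no class size to track.\<close>

definition class_fun :: "(nat \<Rightarrow> 'a) \<Rightarrow> (nat \<Rightarrow> 'a) \<Rightarrow> complex" where
  "class_fun g p = (\<Sum>h\<in>carrier P. indicator {h \<otimes>\<^bsub>P\<^esub> g \<otimes>\<^bsub>P\<^esub> inv\<^bsub>P\<^esub> h} p)"

lemma class_fun_commute:
  assumes g: "g \<in> carrier P" and x: "x \<in> carrier P" and y: "y \<in> carrier P"
  shows "class_fun g (x \<otimes>\<^bsub>P\<^esub> y) = class_fun g (y \<otimes>\<^bsub>P\<^esub> x)"
proof -
  note [simp del] = carrier_product_group mult_product_group inv_product_group one_product_group
  have "class_fun g (x \<otimes>\<^bsub>P\<^esub> y) =
     (\<Sum>h\<in>carrier P. indicator {(x \<otimes>\<^bsub>P\<^esub> h) \<otimes>\<^bsub>P\<^esub> g \<otimes>\<^bsub>P\<^esub> inv\<^bsub>P\<^esub> (x \<otimes>\<^bsub>P\<^esub> h)} (x \<otimes>\<^bsub>P\<^esub> y))"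
    unfolding class_fun_def by (rule P.sum_lmult[OF x, symmetric])
  also have "\<dots> = class_fun g (y \<otimes>\<^bsub>P\<^esub> x)"
    unfolding class_fun_def
  proof (rule sum.cong[OF refl])
    fix h assume h: "h \<in> carrier P"
    define k where "k = h \<otimes>\<^bsub>P\<^esub> g \<otimes>\<^bsub>P\<^esub> inv\<^bsub>P\<^esub> h"
    have k: "k \<in> carrier P" using g h by (simp add: k_def)
    have e: "(x \<otimes>\<^bsub>P\<^esub> h) \<otimes>\<^bsub>P\<^esub> g \<otimes>\<^bsub>P\<^esub> inv\<^bsub>P\<^esub> (x \<otimes>\<^bsub>P\<^esub> h) = x \<otimes>\<^bsub>P\<^esub> k \<otimes>\<^bsub>P\<^esub> inv\<^bsub>P\<^esub> x"
      using g h x by (simp add: k_def P.m_assoc P.inv_mult_group)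
    have "x \<otimes>\<^bsub>P\<^esub> y = x \<otimes>\<^bsub>P\<^esub> k \<otimes>\<^bsub>P\<^esub> inv\<^bsub>P\<^esub> x \<longleftrightarrow> y \<otimes>\<^bsub>P\<^esub> x = k"
    proof
      assume "x \<otimes>\<^bsub>P\<^esub> y = x \<otimes>\<^bsub>P\<^esub> k \<otimes>\<^bsub>P\<^esub> inv\<^bsub>P\<^esub> x"
      then have "y = k \<otimes>\<^bsub>P\<^esub> inv\<^bsub>P\<^esub> x" using x y k by (metis P.inv_closed P.inv_mult_cancel(1) P.m_assoc P.m_closed)
      then show "y \<otimes>\<^bsub>P\<^esub> x = k" using x k by (simp add: P.m_assoc)
    next
      assume "y \<otimes>\<^bsub>P\<^esub> x = k"
      then show "x \<otimes>\<^bsub>P\<^esub> y = x \<otimes>\<^bsub>P\<^esub> k \<otimes>\<^bsub>P\<^esub> inv\<^bsub>P\<^esub> x" using x y by (auto simp: P.m_assoc)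
    qed
    then show "indicator {(x \<otimes>\<^bsub>P\<^esub> h) \<otimes>\<^bsub>P\<^esub> g \<otimes>\<^bsub>P\<^esub> inv\<^bsub>P\<^esub> (x \<otimes>\<^bsub>P\<^esub> h)} (x \<otimes>\<^bsub>P\<^esub> y) =
       (indicator {h \<otimes>\<^bsub>P\<^esub> g \<otimes>\<^bsub>P\<^esub> inv\<^bsub>P\<^esub> h} (y \<otimes>\<^bsub>P\<^esub> x) :: complex)"
      by (simp only: e k_def[symmetric] indicator_def singleton_iff)
  qed
  finally show ?thesis .
qed

abbreviation "class_cyl g \<equiv> (\<lambda>x. class_fun g (proj x))"

lemma class_cyl_in_ZL1: "g \<in> carrier P \<Longrightarrow> class_cyl g \<in> ZL1 G"
  by (intro class_cylinder_in_ZL1[where f = "class_fun g"] class_fun_commute refl)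

text \<open>Each h contributes one point indicator, which picks out a single translate of
  \<open>coef a\<close>. The class of inv g appears because convolution shifts by the
  inverse.\<close>

lemma conv_class_cyl:
  assumes g: "g \<in> carrier P" and a: "integrable Q a" and x: "x \<in> carrier U"
  shows "conv G (class_cyl g) a x =
      (\<Sum>h\<in>carrier P. coef a (h \<otimes>\<^bsub>P\<^esub> inv\<^bsub>P\<^esub> g \<otimes>\<^bsub>P\<^esub> inv\<^bsub>P\<^esub> h \<otimes>\<^bsub>P\<^esub> proj x))"
    and "conv G a (class_cyl g) x =
      (\<Sum>h\<in>carrier P. coef a (h \<otimes>\<^bsub>P\<^esub> inv\<^bsub>P\<^esub> g \<otimes>\<^bsub>P\<^esub> inv\<^bsub>P\<^esub> h \<otimes>\<^bsub>P\<^esub> proj x))"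
proof -
  have k: "h \<otimes>\<^bsub>P\<^esub> g \<otimes>\<^bsub>P\<^esub> inv\<^bsub>P\<^esub> h \<in> carrier P" if "h \<in> carrier P" for h
    using that g by (intro P.m_closed P.inv_closed)
  have ik: "inv\<^bsub>P\<^esub> (h \<otimes>\<^bsub>P\<^esub> g \<otimes>\<^bsub>P\<^esub> inv\<^bsub>P\<^esub> h) = h \<otimes>\<^bsub>P\<^esub> inv\<^bsub>P\<^esub> g \<otimes>\<^bsub>P\<^esub> inv\<^bsub>P\<^esub> h" if "h \<in> carrier P" for h
    using that g by (simp add: P.inv_mult_group P.m_assoc
        del: carrier_product_group mult_product_group inv_product_group one_product_group)
  have px: "proj x \<in> carrier P" by (rule proj_closed[OF x])
  have "conv G (class_cyl g) a x =
     (\<Sum>u\<in>carrier P. \<Sum>h\<in>carrier P. coef a u * indicator {h \<otimes>\<^bsub>P\<^esub> g \<otimes>\<^bsub>P\<^esub> inv\<^bsub>P\<^esub> h} (proj x \<otimes>\<^bsub>P\<^esub> inv\<^bsub>P\<^esub> u))"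
    unfolding conv_cylinder_left[OF a x] by (simp only: class_fun_def sum_distrib_left)
  also have "\<dots> = (\<Sum>h\<in>carrier P. coef a (inv\<^bsub>P\<^esub> (h \<otimes>\<^bsub>P\<^esub> g \<otimes>\<^bsub>P\<^esub> inv\<^bsub>P\<^esub> h) \<otimes>\<^bsub>P\<^esub> proj x))"
    by (subst sum.swap, rule sum.cong[OF refl], rule sum_indicator_rdiv(2)[OF k px])
  finally show 1: "conv G (class_cyl g) a x =
      (\<Sum>h\<in>carrier P. coef a (h \<otimes>\<^bsub>P\<^esub> inv\<^bsub>P\<^esub> g \<otimes>\<^bsub>P\<^esub> inv\<^bsub>P\<^esub> h \<otimes>\<^bsub>P\<^esub> proj x))"
    using ik by simp
  have "conv G a (class_cyl g) x = conv G (class_cyl g) a x"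
    unfolding conv_cylinder_left[OF a x] conv_cylinder_right[OF a x]
    using px by (intro sum.cong refl arg_cong2[of _ _ _ _ "(*)"] class_fun_commute[OF g] P.inv_closed)
  then show "conv G a (class_cyl g) x =
      (\<Sum>h\<in>carrier P. coef a (h \<otimes>\<^bsub>P\<^esub> inv\<^bsub>P\<^esub> g \<otimes>\<^bsub>P\<^esub> inv\<^bsub>P\<^esub> h \<otimes>\<^bsub>P\<^esub> proj x))"
    by (simp only: 1)
qed

lemma coef_commute:
  assumes a: "a \<in> ZL1 G" and x: "x \<in> carrier P" and y: "y \<in> carrier P"
  shows "coef a (x \<otimes>\<^bsub>P\<^esub> y) = coef a (y \<otimes>\<^bsub>P\<^esub> x)"
proof -
  have "coef a (x \<otimes>\<^bsub>P\<^esub> y) = coef a (y \<otimes>\<^bsub>P\<^esub> (x \<otimes>\<^bsub>P\<^esub> y) \<otimes>\<^bsub>P\<^esub> inv\<^bsub>P\<^esub> y)"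
    by (rule coef_class_function[OF a y P.m_closed[OF x y], symmetric])
  also have "y \<otimes>\<^bsub>P\<^esub> (x \<otimes>\<^bsub>P\<^esub> y) \<otimes>\<^bsub>P\<^esub> inv\<^bsub>P\<^esub> y = y \<otimes>\<^bsub>P\<^esub> x"
    using x y by (simp add: P.m_assoc
        del: carrier_product_group mult_product_group inv_product_group one_product_group)
  finally show ?thesis .
qed

text \<open>By \<open>conv_class_cyl\<close> both products are cylinder functions. Reindexing h by x
  h and using that \<open>coef a\<close> is a class function shows that they are central.\<close>

lemma
  assumes g: "g \<in> carrier P" and a: "a \<in> ZL1 G"
  shows conv_class_cyl_in_ZL1: "conv G (class_cyl g) a \<in> ZL1 G" "conv G a (class_cyl g) \<in> ZL1 G"
proof -
  note [simp del] = carrier_product_group mult_product_group inv_product_group one_product_group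
  have comm: "(\<Sum>h\<in>carrier P. coef a (h \<otimes>\<^bsub>P\<^esub> inv\<^bsub>P\<^esub> g \<otimes>\<^bsub>P\<^esub> inv\<^bsub>P\<^esub> h \<otimes>\<^bsub>P\<^esub> (x \<otimes>\<^bsub>P\<^esub> y))) =
     (\<Sum>h\<in>carrier P. coef a (h \<otimes>\<^bsub>P\<^esub> inv\<^bsub>P\<^esub> g \<otimes>\<^bsub>P\<^esub> inv\<^bsub>P\<^esub> h \<otimes>\<^bsub>P\<^esub> (y \<otimes>\<^bsub>P\<^esub> x)))"
    if x: "x \<in> carrier P" and y: "y \<in> carrier P" for x y
  proof -
    have "(\<Sum>h\<in>carrier P. coef a (h \<otimes>\<^bsub>P\<^esub> inv\<^bsub>P\<^esub> g \<otimes>\<^bsub>P\<^esub> inv\<^bsub>P\<^esub> h \<otimes>\<^bsub>P\<^esub> (x \<otimes>\<^bsub>P\<^esub> y))) =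
      (\<Sum>h\<in>carrier P. coef a ((x \<otimes>\<^bsub>P\<^esub> h) \<otimes>\<^bsub>P\<^esub> inv\<^bsub>P\<^esub> g \<otimes>\<^bsub>P\<^esub> inv\<^bsub>P\<^esub> (x \<otimes>\<^bsub>P\<^esub> h) \<otimes>\<^bsub>P\<^esub> (x \<otimes>\<^bsub>P\<^esub> y)))"
      by (rule P.sum_lmult[OF x, symmetric])
    also have "\<dots> = (\<Sum>h\<in>carrier P. coef a (h \<otimes>\<^bsub>P\<^esub> inv\<^bsub>P\<^esub> g \<otimes>\<^bsub>P\<^esub> inv\<^bsub>P\<^esub> h \<otimes>\<^bsub>P\<^esub> (y \<otimes>\<^bsub>P\<^esub> x)))"
    proof (rule sum.cong[OF refl])
      fix h assume h: "h \<in> carrier P"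
      define k where "k = h \<otimes>\<^bsub>P\<^esub> inv\<^bsub>P\<^esub> g \<otimes>\<^bsub>P\<^esub> inv\<^bsub>P\<^esub> h"
      have k: "k \<in> carrier P" using g h by (simp add: k_def)
      have "(x \<otimes>\<^bsub>P\<^esub> h) \<otimes>\<^bsub>P\<^esub> inv\<^bsub>P\<^esub> g \<otimes>\<^bsub>P\<^esub> inv\<^bsub>P\<^esub> (x \<otimes>\<^bsub>P\<^esub> h) \<otimes>\<^bsub>P\<^esub> (x \<otimes>\<^bsub>P\<^esub> y) = x \<otimes>\<^bsub>P\<^esub> (k \<otimes>\<^bsub>P\<^esub> y)"
        using g h x y by (simp add: k_def P.m_assoc P.inv_mult_group)
      then have "coef a ((x \<otimes>\<^bsub>P\<^esub> h) \<otimes>\<^bsub>P\<^esub> inv\<^bsub>P\<^esub> g \<otimes>\<^bsub>P\<^esub> inv\<^bsub>P\<^esub> (x \<otimes>\<^bsub>P\<^esub> h) \<otimes>\<^bsub>P\<^esub> (x \<otimes>\<^bsub>P\<^esub> y)) = coef a (x \<otimes>\<^bsub>P\<^esub> (k \<otimes>\<^bsub>P\<^esub> y))"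
        by simp
      also have "\<dots> = coef a (k \<otimes>\<^bsub>P\<^esub> y \<otimes>\<^bsub>P\<^esub> x)" using x y k by (intro coef_commute[OF a]) auto
      also have "k \<otimes>\<^bsub>P\<^esub> y \<otimes>\<^bsub>P\<^esub> x = k \<otimes>\<^bsub>P\<^esub> (y \<otimes>\<^bsub>P\<^esub> x)" using x y k by (rule_tac P.m_assoc)
      finally show "coef a ((x \<otimes>\<^bsub>P\<^esub> h) \<otimes>\<^bsub>P\<^esub> inv\<^bsub>P\<^esub> g \<otimes>\<^bsub>P\<^esub> inv\<^bsub>P\<^esub> (x \<otimes>\<^bsub>P\<^esub> h) \<otimes>\<^bsub>P\<^esub> (x \<otimes>\<^bsub>P\<^esub> y)) =
         coef a (h \<otimes>\<^bsub>P\<^esub> inv\<^bsub>P\<^esub> g \<otimes>\<^bsub>P\<^esub> inv\<^bsub>P\<^esub> h \<otimes>\<^bsub>P\<^esub> (y \<otimes>\<^bsub>P\<^esub> x))" by (simp add: k_def)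
    qed
    finally show ?thesis .
  qed
  show "conv G (class_cyl g) a \<in> ZL1 G" "conv G a (class_cyl g) \<in> ZL1 G"
    by (rule class_cylinder_in_ZL1[OF comm conv_class_cyl(1)[OF g ZL1_integrable[OF a]]], assumption+)
       (rule class_cylinder_in_ZL1[OF comm conv_class_cyl(2)[OF g ZL1_integrable[OF a]]], assumption+)
qed

lemma coef_conv_class_cyl:
  assumes g: "g \<in> carrier P" and a: "integrable Q a" and p: "p \<in> carrier P"
  shows "coef (conv G (class_cyl g) a) p =
      (\<Sum>h\<in>carrier P. coef a (h \<otimes>\<^bsub>P\<^esub> inv\<^bsub>P\<^esub> g \<otimes>\<^bsub>P\<^esub> inv\<^bsub>P\<^esub> h \<otimes>\<^bsub>P\<^esub> p)) / card (carrier P)"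
    and "coef (conv G a (class_cyl g)) p =
      (\<Sum>h\<in>carrier P. coef a (h \<otimes>\<^bsub>P\<^esub> inv\<^bsub>P\<^esub> g \<otimes>\<^bsub>P\<^esub> inv\<^bsub>P\<^esub> h \<otimes>\<^bsub>P\<^esub> p)) / card (carrier P)"
proof -
  let ?f = "\<lambda>p. \<Sum>h\<in>carrier P. coef a (h \<otimes>\<^bsub>P\<^esub> inv\<^bsub>P\<^esub> g \<otimes>\<^bsub>P\<^esub> inv\<^bsub>P\<^esub> h \<otimes>\<^bsub>P\<^esub> p)"
  have "coef (conv G (class_cyl g) a) p = coef (\<lambda>x. ?f (proj x)) p"
    "coef (conv G a (class_cyl g)) p = coef (\<lambda>x. ?f (proj x)) p"
    by (rule coef_cong, rule conv_class_cyl[OF g a], assumption)+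
  then show "coef (conv G (class_cyl g) a) p = ?f p / card (carrier P)"
    "coef (conv G a (class_cyl g)) p = ?f p / card (carrier P)"
    by (simp_all only: coef_cylinder[OF p, where f = ?f])
qed

lemma conv_uminus: "conv G (\<lambda>x. - a x) b x = - conv G a b x" "conv G b (\<lambda>x. - a x) x = - conv G b a x"
  by (simp_all add: conv_def del: mult_product_group)

lemma ZL1_uminus: "a \<in> ZL1 G \<Longrightarrow> (\<lambda>x. - a x) \<in> ZL1 G"
  unfolding ZL1_def by (simp only: mem_Collect_eq conv_uminus neg_equal_iff_equal) simp

lemma tensor_rep_diff:
  assumes u: "tensor_rep G u" and v: "tensor_rep G v"
  shows "tensor_rep G (tensor_diff u v)"
  unfolding tensor_rep_def
proof
  show "\<forall>n. fst (tensor_diff u v n) \<in> ZL1 G \<and> snd (tensor_diff u v n) \<in> ZL1 G"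
    using tensor_repD(1,2)[OF u] tensor_repD(1,2)[OF v] by (simp add: tensor_diff_def ZL1_uminus)
  have "(\<lambda>n. L1norm G (fst (tensor_diff u v n)) * L1norm G (snd (tensor_diff u v n))) =
    (\<lambda>n. if even n then (\<lambda>k. L1norm G (fst (u k)) * L1norm G (snd (u k))) (n div 2)
         else (\<lambda>k. L1norm G (fst (v k)) * L1norm G (snd (v k))) (n div 2))"
    by (auto simp: tensor_diff_def L1norm_def fun_eq_iff)
  then show "summable (\<lambda>n. L1norm G (fst (tensor_diff u v n)) * L1norm G (snd (tensor_diff u v n)))"
    using sums_interleave[OF summable_sums[OF tensor_repD(5)[OF u]] summable_sums[OF tensor_repD(5)[OF v]]]
    by (simp add: sums_iff)
qed

lemma tensor_coef_diff:
  assumes u: "tensor_rep G u" and v: "tensor_rep G v" and x: "x \<in> carrier P" and y: "y \<in> carrier P"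
  shows "tensor_coef (tensor_diff u v) x y = tensor_coef u x y - tensor_coef v x y"
proof -
  have "(\<lambda>n. coef (fst (tensor_diff u v n)) x * coef (snd (tensor_diff u v n)) y) =
    (\<lambda>n. if even n then (\<lambda>k. coef (fst (u k)) x * coef (snd (u k)) y) (n div 2)
         else (\<lambda>k. - (coef (fst (v k)) x * coef (snd (v k)) y)) (n div 2))"
    by (auto simp: tensor_diff_def coef_uminus fun_eq_iff)
  then show ?thesis
    using sums_interleave[OF tensor_coef_sums[OF u x y] sums_minus[OF tensor_coef_sums[OF v x y]]]
    by (simp add: sums_iff tensor_coef_def)
qed

lemma
  assumes u: "tensor_rep G u" and g: "g \<in> carrier P"
  shows tensor_rep_lmod: "tensor_rep G (lmod G (class_cyl g) u)"
    and tensor_rep_rmod: "tensor_rep G (rmod G u (class_cyl g))"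
proof -
  let ?L = "L1norm G"
  have c: "integrable Q (class_cyl g)" by (rule ZL1_integrable[OF class_cyl_in_ZL1[OF g]])
  have s: "summable (\<lambda>k. ?L (class_cyl g) * (?L (fst (u k)) * ?L (snd (u k))))"
    using tensor_repD(5)[OF u] by (rule summable_mult)
  have "summable (\<lambda>k. ?L (conv G (class_cyl g) (fst (u k))) * ?L (snd (u k)))"
  proof (rule summable_comparison_test'[OF s])
    fix k
    have "?L (conv G (class_cyl g) (fst (u k))) * ?L (snd (u k)) \<le> ?L (class_cyl g) * ?L (fst (u k)) * ?L (snd (u k))"
      using tensor_repD[OF u] c by (intro mult_right_mono L1norm_conv_le L1norm_nonneg)
    then show "norm (?L (conv G (class_cyl g) (fst (u k))) * ?L (snd (u k))) \<le> ?L (class_cyl g) * (?L (fst (u k)) * ?L (snd (u k)))"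
      by (simp add: L1norm_nonneg mult.assoc)
  qed
  then show "tensor_rep G (lmod G (class_cyl g) u)"
    using tensor_repD(1,2)[OF u] conv_class_cyl_in_ZL1(1)[OF g] by (simp add: tensor_rep_def lmod_def)
  have "summable (\<lambda>k. ?L (fst (u k)) * ?L (conv G (snd (u k)) (class_cyl g)))"
  proof (rule summable_comparison_test'[OF s])
    fix k
    have "?L (fst (u k)) * ?L (conv G (snd (u k)) (class_cyl g)) \<le> ?L (fst (u k)) * (?L (snd (u k)) * ?L (class_cyl g))"
      using tensor_repD[OF u] c by (intro mult_left_mono L1norm_conv_le L1norm_nonneg)
    then show "norm (?L (fst (u k)) * ?L (conv G (snd (u k)) (class_cyl g))) \<le> ?L (class_cyl g) * (?L (fst (u k)) * ?L (snd (u k)))"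
      by (simp add: L1norm_nonneg mult_ac)
  qed
  then show "tensor_rep G (rmod G u (class_cyl g))"
    using tensor_repD(1,2)[OF u] conv_class_cyl_in_ZL1(2)[OF g] by (simp add: tensor_rep_def rmod_def)
qed

lemma tensor_coef_lmod:
  assumes u: "tensor_rep G u" and g: "g \<in> carrier P" and x: "x \<in> carrier P" and y: "y \<in> carrier P"
  shows "tensor_coef (lmod G (class_cyl g) u) x y =
    (\<Sum>h\<in>carrier P. tensor_coef u (h \<otimes>\<^bsub>P\<^esub> inv\<^bsub>P\<^esub> g \<otimes>\<^bsub>P\<^esub> inv\<^bsub>P\<^esub> h \<otimes>\<^bsub>P\<^esub> x) y) / card (carrier P)"
proof -
  have c: "h \<otimes>\<^bsub>P\<^esub> inv\<^bsub>P\<^esub> g \<otimes>\<^bsub>P\<^esub> inv\<^bsub>P\<^esub> h \<otimes>\<^bsub>P\<^esub> x \<in> carrier P" if "h \<in> carrier P" for h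
    using that g x by (intro P.m_closed P.inv_closed)
  have "(\<lambda>k. (\<Sum>h\<in>carrier P. coef (fst (u k)) (h \<otimes>\<^bsub>P\<^esub> inv\<^bsub>P\<^esub> g \<otimes>\<^bsub>P\<^esub> inv\<^bsub>P\<^esub> h \<otimes>\<^bsub>P\<^esub> x) * coef (snd (u k)) y) / card (carrier P)) sums
     ((\<Sum>h\<in>carrier P. tensor_coef u (h \<otimes>\<^bsub>P\<^esub> inv\<^bsub>P\<^esub> g \<otimes>\<^bsub>P\<^esub> inv\<^bsub>P\<^esub> h \<otimes>\<^bsub>P\<^esub> x) y) / card (carrier P))"
    by (intro sums_divide sums_sum tensor_coef_sums[OF u c y])
  moreover have "tensor_coef (lmod G (class_cyl g) u) x y =
      (\<Sum>k. coef (conv G (class_cyl g) (fst (u k))) x * coef (snd (u k)) y)"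
    by (simp only: tensor_coef_def lmod_def fst_conv snd_conv)
  ultimately show ?thesis
    unfolding coef_conv_class_cyl(1)[OF g tensor_repD(3)[OF u] x]
    by (simp only: sums_iff sum_distrib_right times_divide_eq_left)
qed

text \<open>At the identity the average in the second variable runs over the class of inv g alone,
  where the masses of a central function are constant. The average thus collapses to one entry,
  which is why the diagonal identity is read there.\<close>

lemma tensor_coef_rmod_one:
  assumes u: "tensor_rep G u" and g: "g \<in> carrier P"
  shows "tensor_coef (rmod G u (class_cyl g)) x \<one>\<^bsub>P\<^esub> = tensor_coef u x (inv\<^bsub>P\<^esub> g)"
proof -
  have "coef (conv G (snd (u k)) (class_cyl g)) \<one>\<^bsub>P\<^esub> = coef (snd (u k)) (inv\<^bsub>P\<^esub> g)" for k
  proof -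
    have "(\<Sum>h\<in>carrier P. coef (snd (u k)) (h \<otimes>\<^bsub>P\<^esub> inv\<^bsub>P\<^esub> g \<otimes>\<^bsub>P\<^esub> inv\<^bsub>P\<^esub> h \<otimes>\<^bsub>P\<^esub> \<one>\<^bsub>P\<^esub>)) =
       (\<Sum>h\<in>carrier P. coef (snd (u k)) (inv\<^bsub>P\<^esub> g))"
    proof (rule sum.cong[OF refl])
      fix h assume h: "h \<in> carrier P"
      then show "coef (snd (u k)) (h \<otimes>\<^bsub>P\<^esub> inv\<^bsub>P\<^esub> g \<otimes>\<^bsub>P\<^esub> inv\<^bsub>P\<^esub> h \<otimes>\<^bsub>P\<^esub> \<one>\<^bsub>P\<^esub>) = coef (snd (u k)) (inv\<^bsub>P\<^esub> g)"
        using g coef_class_function[OF tensor_repD(2)[OF u] h P.inv_closed[OF g]]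
        by (simp only: P.r_one P.m_closed P.inv_closed)
    qed
    then show ?thesis
      using P.card_pos unfolding coef_conv_class_cyl(2)[OF g tensor_repD(4)[OF u] P.one_closed]
      by simp
  qed
  then show ?thesis by (simp only: tensor_coef_def rmod_def fst_conv snd_conv)
qed

lemma tensor_coef_diagonal_le:
  assumes u: "tensor_rep G u" and g: "g \<in> carrier P" and x: "x \<in> carrier P"
  shows "cmod ((\<Sum>h\<in>carrier P. tensor_coef u (h \<otimes>\<^bsub>P\<^esub> inv\<^bsub>P\<^esub> g \<otimes>\<^bsub>P\<^esub> inv\<^bsub>P\<^esub> h \<otimes>\<^bsub>P\<^esub> x) \<one>\<^bsub>P\<^esub>) / card (carrier P) -
     tensor_coef u x (inv\<^bsub>P\<^esub> g)) \<le> proj_norm G (tensor_diff (lmod G (class_cyl g) u) (rmod G u (class_cyl g)))"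
proof -
  let ?d = "tensor_diff (lmod G (class_cyl g) u) (rmod G u (class_cyl g))"
  have "tensor_coef ?d x \<one>\<^bsub>P\<^esub> = (\<Sum>h\<in>carrier P. tensor_coef u (h \<otimes>\<^bsub>P\<^esub> inv\<^bsub>P\<^esub> g \<otimes>\<^bsub>P\<^esub> inv\<^bsub>P\<^esub> h \<otimes>\<^bsub>P\<^esub> x) \<one>\<^bsub>P\<^esub>) / card (carrier P) -
     tensor_coef u x (inv\<^bsub>P\<^esub> g)"
    unfolding tensor_coef_diff[OF tensor_rep_lmod[OF u g] tensor_rep_rmod[OF u g] x P.one_closed]
      tensor_coef_lmod[OF u g x P.one_closed] tensor_coef_rmod_one[OF u g] ..
  \<comment> \<open>A single matrix entry is the value of a test form with one nonzero weight, so it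
    is controlled by the projective norm.\<close>
  moreover have "cmod (tensor_coef ?d x \<one>\<^bsub>P\<^esub>) \<le> proj_norm G ?d"
    using coef_form_suminf_le_proj_norm[OF _ tensor_rep_diff[OF tensor_rep_lmod[OF u g] tensor_rep_rmod[OF u g]],
        of "\<lambda>x' y'. if x' = x \<and> y' = \<one>\<^bsub>P\<^esub> then 1 else 0"]
    by (simp only: coef_form_single[OF x P.one_closed] tensor_coef_def) simp
  ultimately show ?thesis by (simp only:)
qed

end

section \<open>The multiplication map at level n\<close>

text \<open>\<open>mult_map\<close> is a pointwise series, so its integration needs absolute
  convergence almost everywhere. This holds because the nonnegative series of norms has finite
  integral.\<close>

lemma AE_summable_norm:
  fixes c :: "nat \<Rightarrow> 'b \<Rightarrow> 'c :: {banach, second_countable_topology}"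
  assumes c: "\<And>k. integrable M (c k)" and s: "summable (\<lambda>k. \<integral>x. norm (c k x) \<partial>M)"
  shows "AE x in M. summable (\<lambda>k. norm (c k x))"
proof -
  have m[measurable]: "(\<lambda>x. ennreal (norm (c k x))) \<in> borel_measurable M" for k
    using c[of k] by measurable
  have "(\<integral>\<^sup>+x. (\<Sum>k. ennreal (norm (c k x))) \<partial>M) = (\<Sum>k. \<integral>\<^sup>+x. ennreal (norm (c k x)) \<partial>M)"
    using m by (rule nn_integral_suminf)
  also have "\<dots> = (\<Sum>k. ennreal (\<integral>x. norm (c k x) \<partial>M))"
    using c by (simp add: nn_integral_eq_integral)
  also have "\<dots> \<noteq> \<infinity>"
    unfolding infinity_ennreal_def
    by (rule ennreal_suminf_neq_top[OF s]) (rule integral_nonneg_AE, simp)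
  finally have "AE x in M. (\<Sum>k. ennreal (norm (c k x))) \<noteq> \<infinity>"
    by (intro nn_integral_PInf_AE) measurable
  then show ?thesis
  proof eventually_elim
    case (elim x)
    then show ?case
      unfolding infinity_ennreal_def by (intro summable_suminf_not_top) auto
  qed
qed

context fin_group_seq
begin

lemma
  assumes u: "tensor_rep G u"
  shows integrable_mult_map: "integrable Q (mult_map G u)"
    and coef_mult_map: "p \<in> carrier P \<Longrightarrow>
      coef (mult_map G u) p = (\<Sum>v\<in>carrier P. tensor_coef u v (inv\<^bsub>P\<^esub> v \<otimes>\<^bsub>P\<^esub> p))"
proof -
  define c where "c k = conv G (fst (u k)) (snd (u k))" for k
  have ic: "integrable Q (c k)" for k
    unfolding c_def using tensor_repD[OF u] by (intro integrable_conv)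
  have sc: "summable (\<lambda>k. \<integral>x. cmod (c k x) \<partial>Q)"
  proof (rule summable_comparison_test'[OF tensor_repD(5)[OF u]])
    fix k
    show "norm (\<integral>x. cmod (c k x) \<partial>Q) \<le> L1norm G (fst (u k)) * L1norm G (snd (u k))"
      using L1norm_conv_le[OF tensor_repD(3,4)[OF u], of k k] by (simp add: c_def L1norm_def)
  qed
  have AE: "AE x in Q. summable (\<lambda>k. cmod (c k x))"
    using ic sc by (rule AE_summable_norm)
  show "integrable Q (mult_map G u)"
    unfolding mult_map_def c_def[symmetric] by (rule integrable_suminf[OF ic AE sc])
  assume p: "p \<in> carrier P"
  let ?i = "\<lambda>x. indicator {p} (proj x) :: complex"
  have ii: "integrable Q (\<lambda>x. c k x * ?i x)" for k using ic by (rule integrable_mult_cylinder)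
  have ile: "cmod (c k x * ?i x) \<le> cmod (c k x)" for k x by (auto simp: indicator_def)
  \<comment> \<open>The indicator is 0 or 1 at each point, so it may be moved into the series even
    where the series does not converge.\<close>
  have "coef (mult_map G u) p = (\<integral>x. (\<Sum>k. c k x * ?i x) \<partial>Q)"
    unfolding coef_def mult_map_def c_def[symmetric]
    by (rule Bochner_Integration.integral_cong[OF refl]) (auto simp: indicator_def)
  also have "(\<lambda>k. coef (c k) p) sums \<dots>"
    unfolding coef_def
  proof (rule sums_integral[OF ii])
    show "AE x in Q. summable (\<lambda>k. cmod (c k x * ?i x))"
      using AE
    proof eventually_elim
      case (elim x)
      show ?case
        by (rule summable_comparison_test'[OF elim]) (simp only: real_norm_def abs_norm_cancel ile)
    qed
    show "summable (\<lambda>k. \<integral>x. cmod (c k x * ?i x) \<partial>Q)"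
    proof (rule summable_comparison_test'[OF sc])
      fix k
      have "(\<integral>x. cmod (c k x * ?i x) \<partial>Q) \<le> (\<integral>x. cmod (c k x) \<partial>Q)"
        using ic ii ile by (intro integral_mono integrable_norm)
      then show "norm (\<integral>x. cmod (c k x * ?i x) \<partial>Q) \<le> (\<integral>x. cmod (c k x) \<partial>Q)" by simp
    qed
  qed
  finally have "(\<lambda>k. coef (c k) p) sums coef (mult_map G u) p" .
  moreover have "(\<lambda>k. coef (c k) p) sums (\<Sum>v\<in>carrier P. tensor_coef u v (inv\<^bsub>P\<^esub> v \<otimes>\<^bsub>P\<^esub> p))"
    unfolding c_def coef_conv[OF tensor_repD(3,4)[OF u] p] using p
    by (intro sums_sum tensor_coef_sums[OF u] P.m_closed P.inv_closed)
  ultimately show "coef (mult_map G u) p = (\<Sum>v\<in>carrier P. tensor_coef u v (inv\<^bsub>P\<^esub> v \<otimes>\<^bsub>P\<^esub> p))"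
    by (rule sums_unique2)
qed

text \<open>The normalised indicator of the kernel of \<open>proj\<close>. Its fiber masses are the
  point mass at the identity, so convolving with it from the right averages over fibers.\<close>

definition unit_cyl :: "(nat \<Rightarrow> 'a) \<Rightarrow> complex" where
  "unit_cyl x = of_nat (card (carrier P)) * indicator {\<one>\<^bsub>P\<^esub>} (proj x)"

lemma unit_cyl_in_ZL1: "unit_cyl \<in> ZL1 G"
proof (rule class_cylinder_in_ZL1[where f = "\<lambda>p. of_nat (card (carrier P)) * indicator {\<one>\<^bsub>P\<^esub>} p"])
  fix x y assume "x \<in> carrier P" "y \<in> carrier P"
  then have "x \<otimes>\<^bsub>P\<^esub> y = \<one>\<^bsub>P\<^esub> \<longleftrightarrow> y \<otimes>\<^bsub>P\<^esub> x = \<one>\<^bsub>P\<^esub>"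
    using P.inv_comm by blast
  then show "of_nat (card (carrier P)) * indicator {\<one>\<^bsub>P\<^esub>} (x \<otimes>\<^bsub>P\<^esub> y) =
     (of_nat (card (carrier P)) * indicator {\<one>\<^bsub>P\<^esub>} (y \<otimes>\<^bsub>P\<^esub> x) :: complex)"
    by (simp only: indicator_def singleton_iff)
qed (simp only: unit_cyl_def)

text \<open>Averaging over fibers does not change fiber masses, so the mass of the difference at p
  is \<open>coef a p\<close> minus the point mass, and a single mass is bounded by the L1
  norm.\<close>

lemma coef_approx_unit_le:
  assumes a: "integrable Q a" and p: "p \<in> carrier P"
  shows "cmod (coef a p - of_real (unit_ind P p)) \<le> L1norm G (\<lambda>x. conv G a unit_cyl x - unit_cyl x)"
proof -
  let ?N = "complex_of_nat (card (carrier P))"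
  let ?f = "\<lambda>q. ?N * coef a q - ?N * indicator {\<one>\<^bsub>P\<^esub>} q"
  have eq: "conv G a unit_cyl x - unit_cyl x = ?f (proj x)" if x: "x \<in> carrier U" for x
  proof -
    have px: "proj x \<in> carrier P" by (rule proj_closed[OF x])
    have "conv G a unit_cyl x = (\<Sum>u\<in>carrier P. coef a u * (?N * indicator {\<one>\<^bsub>P\<^esub>} (inv\<^bsub>P\<^esub> u \<otimes>\<^bsub>P\<^esub> proj x)))"
      unfolding unit_cyl_def by (rule conv_cylinder_right[OF a x, of "\<lambda>p. ?N * indicator {\<one>\<^bsub>P\<^esub>} p"])
    also have "\<dots> = ?N * (\<Sum>u\<in>carrier P. coef a u * indicator {\<one>\<^bsub>P\<^esub>} (inv\<^bsub>P\<^esub> u \<otimes>\<^bsub>P\<^esub> proj x))"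
      by (simp only: sum_distrib_left mult_ac)
    also have "\<dots> = ?N * coef a (proj x)"
      unfolding sum_indicator_rdiv(1)[OF P.one_closed px] using px by (simp only: P.inv_one P.r_one)
    finally show ?thesis by (simp only: unit_cyl_def)
  qed
  have "integrable Q (\<lambda>x. conv G a unit_cyl x - unit_cyl x) \<longleftrightarrow> integrable Q (\<lambda>x. ?f (proj x))"
    by (rule Bochner_Integration.integrable_cong[OF refl]) (simp only: eq space_Q)
  then have i: "integrable Q (\<lambda>x. conv G a unit_cyl x - unit_cyl x)"
    by (rule iffD2) (rule integrable_cylinder[where f = ?f])
  have "coef (\<lambda>x. conv G a unit_cyl x - unit_cyl x) p = coef (\<lambda>x. ?f (proj x)) p"
    by (rule coef_cong[OF eq])
  also have "\<dots> = coef a p - of_real (unit_ind P p)"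
    unfolding coef_cylinder[OF p, where f = ?f] using P.card_pos
    by (simp add: unit_ind_def indicator_def field_simps del: carrier_product_group one_product_group)
  finally show ?thesis using cmod_coef_le[OF i p] by (simp only:)
qed

section \<open>The lower bound at level n\<close>

lemma approx_diagonal_bound_ge:
  assumes nc: "\<And>i. \<not> comm_group (G i)" and F: "F \<noteq> bot"
    and bad: "bounded_approx_diagonal G F \<mu>" and B: "\<And>j. proj_norm G (\<mu> j) \<le> B"
  shows "(5 / 4) ^ n \<le> B"
proof -
  \<comment> \<open>Real parts suffice: the limiting equations and the test matrix are real, and
    passing to real parts does not increase absolute values.\<close>
  define M where "M j x y = Re (tensor_coef (\<mu> j) x y)" for j x y
  have rep: "tensor_rep G (\<mu> j)" for j using bad by (simp add: bounded_approx_diagonal_def)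
  obtain t where t: "\<And>y. y \<in> carrier P \<Longrightarrow> card (carrier P) * comm_op P t y = unit_ind P y"
    and ge: "(5 / 4) ^ card {..<n} \<le> (\<Sum>x\<in>carrier P. card (conj_class P x) * diag_weight P t x)"
    using exists_product_diagonal[OF nc] by blast
  have inv: "M j x (h \<otimes>\<^bsub>P\<^esub> y \<otimes>\<^bsub>P\<^esub> inv\<^bsub>P\<^esub> h) = M j x y"
    if "x \<in> carrier P" "y \<in> carrier P" "h \<in> carrier P" for j x y h
    unfolding M_def tensor_coef_class_function[OF rep that(3,2)] ..
  have diag: "((\<lambda>j. class_avg P y (\<lambda>z. M j z \<one>\<^bsub>P\<^esub>) x - M j x y) \<longlongrightarrow> 0) F"
    if x: "x \<in> carrier P" and y: "y \<in> carrier P" for x y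
  proof -
    \<comment> \<open>Acting with the class of g averages over conjugates of inv g, hence the
      inversion.\<close>
    define g where "g = inv\<^bsub>P\<^esub> y"
    have g: "g \<in> carrier P" and ig: "inv\<^bsub>P\<^esub> g = y"
      using y unfolding g_def by (rule P.inv_closed, rule P.inv_inv)
    have lim: "((\<lambda>j. proj_norm G (tensor_diff (lmod G (class_cyl g) (\<mu> j)) (rmod G (\<mu> j) (class_cyl g)))) \<longlongrightarrow> 0) F"
      using bad class_cyl_in_ZL1[OF g] by (simp add: bounded_approx_diagonal_def)
    show ?thesis
    proof (rule Lim_null_comparison[OF always_eventually lim], rule allI)
      fix j
      let ?c = "(\<Sum>h\<in>carrier P. tensor_coef (\<mu> j) (h \<otimes>\<^bsub>P\<^esub> y \<otimes>\<^bsub>P\<^esub> inv\<^bsub>P\<^esub> h \<otimes>\<^bsub>P\<^esub> x) \<one>\<^bsub>P\<^esub>) / card (carrier P) -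
          tensor_coef (\<mu> j) x y"
      have eq: "class_avg P y (\<lambda>z. M j z \<one>\<^bsub>P\<^esub>) x - M j x y = Re ?c"
        unfolding class_avg_def M_def by (simp only: minus_complex.sel Re_divide_of_nat Re_sum)
      have "norm (Re ?c) \<le> cmod ?c" unfolding real_norm_def by (rule abs_Re_le_cmod)
      also have "\<dots> \<le> proj_norm G (tensor_diff (lmod G (class_cyl g) (\<mu> j)) (rmod G (\<mu> j) (class_cyl g)))"
        using tensor_coef_diagonal_le[OF rep g x] by (simp only: ig)
      finally show "norm (class_avg P y (\<lambda>z. M j z \<one>\<^bsub>P\<^esub>) x - M j x y) \<le>
         proj_norm G (tensor_diff (lmod G (class_cyl g) (\<mu> j)) (rmod G (\<mu> j) (class_cyl g)))"
        unfolding eq .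
    qed
  qed
  have unit: "((\<lambda>j. \<Sum>u\<in>carrier P. M j u (inv\<^bsub>P\<^esub> u \<otimes>\<^bsub>P\<^esub> x)) \<longlongrightarrow> unit_ind P x) F"
    if x: "x \<in> carrier P" for x
  proof -
    have lim: "((\<lambda>j. L1norm G (\<lambda>x. conv G (mult_map G (\<mu> j)) unit_cyl x - unit_cyl x)) \<longlongrightarrow> 0) F"
      using bad unit_cyl_in_ZL1 by (simp add: bounded_approx_diagonal_def)
    have "((\<lambda>j. (\<Sum>u\<in>carrier P. M j u (inv\<^bsub>P\<^esub> u \<otimes>\<^bsub>P\<^esub> x)) - unit_ind P x) \<longlongrightarrow> 0) F"
    proof (rule Lim_null_comparison[OF always_eventually lim], rule allI)
      fix j
      let ?c = "coef (mult_map G (\<mu> j)) x - of_real (unit_ind P x)"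
      have eq: "(\<Sum>u\<in>carrier P. M j u (inv\<^bsub>P\<^esub> u \<otimes>\<^bsub>P\<^esub> x)) - unit_ind P x = Re ?c"
        unfolding M_def coef_mult_map[OF rep x] by (simp only: minus_complex.sel Re_sum Re_complex_of_real)
      have "norm (Re ?c) \<le> cmod ?c" unfolding real_norm_def by (rule abs_Re_le_cmod)
      also have "\<dots> \<le> L1norm G (\<lambda>x. conv G (mult_map G (\<mu> j)) unit_cyl x - unit_cyl x)"
        by (rule coef_approx_unit_le[OF integrable_mult_map[OF rep] x])
      finally show "norm ((\<Sum>u\<in>carrier P. M j u (inv\<^bsub>P\<^esub> u \<otimes>\<^bsub>P\<^esub> x)) - unit_ind P x) \<le>
         L1norm G (\<lambda>x. conv G (mult_map G (\<mu> j)) unit_cyl x - unit_cyl x)"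
        unfolding eq .
    qed
    then show ?thesis by (rule LIM_zero_cancel)
  qed
  \<comment> \<open>The test matrix of the overview: it has entries 0 and 1, so its form has norm at
    most 1.\<close>
  define w where "w x y = (if x \<in> conj_class P (inv\<^bsub>P\<^esub> y) then 1 else 0 :: real)" for x y
  have bound: "(\<Sum>y\<in>carrier P. \<Sum>c\<in>conj_class P y. M j c (inv\<^bsub>P\<^esub> y)) \<le> B" for j
  proof -
    have "(\<Sum>y\<in>carrier P. \<Sum>c\<in>conj_class P y. M j c (inv\<^bsub>P\<^esub> y)) =
        (\<Sum>y\<in>carrier P. \<Sum>x\<in>carrier P. w x (inv\<^bsub>P\<^esub> y) * M j x (inv\<^bsub>P\<^esub> y))"
    proof (rule sum.cong[OF refl])
      fix y assume y: "y \<in> carrier P"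
      have "(\<Sum>x\<in>carrier P. w x (inv\<^bsub>P\<^esub> y) * M j x (inv\<^bsub>P\<^esub> y)) =
         (\<Sum>x\<in>carrier P. if x \<in> conj_class P y then M j x (inv\<^bsub>P\<^esub> y) else 0)"
        using y by (intro sum.cong refl) (simp only: w_def P.inv_inv, simp)
      also have "\<dots> = (\<Sum>c\<in>carrier P \<inter> conj_class P y. M j c (inv\<^bsub>P\<^esub> y))"
        by (rule sum.inter_restrict[OF P.fin, symmetric])
      finally show "(\<Sum>c\<in>conj_class P y. M j c (inv\<^bsub>P\<^esub> y)) =
         (\<Sum>x\<in>carrier P. w x (inv\<^bsub>P\<^esub> y) * M j x (inv\<^bsub>P\<^esub> y))"
        using P.conj_class_subset[OF y] by (simp only: Int_absorb1)
    qed
    \<comment> \<open>Inversion of the second variable turns the entries at (c, y^-1) into a sum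
      over the whole matrix weighted by w.\<close>
    also have "\<dots> = (\<Sum>y\<in>carrier P. \<Sum>x\<in>carrier P. w x y * M j x y)"
      by (rule P.sum_inv)
    also have "\<dots> = (\<Sum>x\<in>carrier P. \<Sum>y\<in>carrier P. w x y * M j x y)"
      by (rule sum.swap)
    also have "\<dots> = Re (\<Sum>k. coef_form w (fst (\<mu> j k)) (snd (\<mu> j k)))"
      unfolding sums_unique[OF coef_form_sums[OF rep], symmetric] M_def
      by (simp only: Re_sum Re_complex_of_real times_complex.sel Im_complex_of_real mult_zero_left diff_zero)
    also have "\<dots> \<le> cmod (\<Sum>k. coef_form w (fst (\<mu> j k)) (snd (\<mu> j k)))"
      by (rule complex_Re_le_cmod)
    also have "\<dots> \<le> proj_norm G (\<mu> j)"
      by (rule coef_form_suminf_le_proj_norm[OF _ rep]) (simp add: w_def)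
    also have "\<dots> \<le> B" by (rule B)
    finally show ?thesis .
  qed
  have "(5 / 4) ^ n \<le> (\<Sum>x\<in>carrier P. card (conj_class P x) * diag_weight P t x)"
    using ge by (simp only: card_lessThan)
  also have "\<dots> \<le> B"
    by (rule P.diag_constant_le_bound[OF F P.approx_diagonal_tendsto[OF t inv diag unit] bound])
  finally show ?thesis .
qed

end

theorem theorem1p10:
  fixes G :: "nat \<Rightarrow> 'a monoid"
  assumes "\<forall>i. group (G i)"
    and "\<forall>i. finite (carrier (G i))"
    and "\<forall>i. \<not> comm_group (G i)"
  shows "\<not> (\<exists>(F :: 'i filter) \<mu>. F \<noteq> bot \<and> bounded_approx_diagonal G F \<mu>)"
proof
  assume "\<exists>(F :: 'i filter) \<mu>. F \<noteq> bot \<and> bounded_approx_diagonal G F \<mu>"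
  then obtain F :: "'i filter" and \<mu> where F: "F \<noteq> bot" and bad: "bounded_approx_diagonal G F \<mu>"
    by blast
  obtain B where B: "\<And>j. proj_norm G (\<mu> j) \<le> B"
    using bad by (auto simp: bounded_approx_diagonal_def)
  \<comment> \<open>The bound B belongs to the net and is fixed before the level n, which is free to
    be chosen after it.\<close>
  obtain n where n: "B < (5 / 4) ^ n"
    using real_arch_pow[of "5 / 4" B] by auto
  interpret fin_group_seq G n
    using assms by (simp add: fin_group_seq_def)
  have "(5 / 4) ^ n \<le> B"
    using assms(3) by (intro approx_diagonal_bound_ge[OF _ F bad B]) blast
  with n show False by simp
qed

end
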